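(* For each $n$ let $\mathbf{p}^{(n)}=(p_1,\dots,p_m)$, $m=m(n)$, be a vector of probabilities such that $n\sum_{i=1}^m p_i^2=c$ for a constant $c>1$, and suppose there exists $\gamma>1/2$ such that $p=\max_i p_i = o(n^{-\gamma})$. Let $G$ be the inhomogeneous random intersection graph with parameters $n$ and $\mathbf{p}^{(n)}$. Then with high probability $G$ has a unique largest component, and this component has size $(1-\rho)n$, where $\rho$ is the unique solution in $[0,1)$ of $$x=\prod_{i=1}^m\Big[1-p_i\big(1-(1-p_i(1-x))^n\big)\Big].$$ All other components have size $O(\max\{np\log n,\ \log n\})$.
   Context: Inhomogeneous random intersection graph: given $n$ vertices $V$, attributes $A=\{a_1,\dots,a_m\}$ and probabilities $\mathbf{p}=(p_i)_{i=1}^m$, let $\mathcal{I}_{v,a_i}$, $(v,a_i)\in V\times A$, be independent Bernoulli$(p_i)$ random variables. The random bipartite graph $B$ on $V\cup A$ has edge $(v,a_i)$ iff $\mathcal{I}_{v,a_i}=1$; the random intersection graph $G$ on $V$ joins two distinct vertices iff they share at least one common attribute in $B$. Results are asymptotic as $n\to\infty$ for a sequence of parameter vectors $\mathbf{p}^{(n)}$; an event holds with high probability if its probability tends to $1$ as $n\to\infty$. *)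

theory Defs
  imports "HOL-Probability.Probability" "HOL-Library.Landau_Symbols"
begin

text \<open>
  The vertex set is \<open>{..<n}\<close> and the attribute set is \<open>{..<m}\<close>. A bipartite graph between
  them is the set of its edges \<open>(v, i)\<close>, where \<open>v\<close> is a vertex and \<open>i\<close> is an attribute.
\<close>

definition random_bipartite :: "nat \<Rightarrow> nat \<Rightarrow> (nat \<Rightarrow> real) \<Rightarrow> (nat \<times> nat) set pmf" where
  "random_bipartite n m p =
     map_pmf (\<lambda>I. {e. I e})
       (Pi_pmf ({..<n} \<times> {..<m}) False (\<lambda>(v, i). bernoulli_pmf (p i)))"

text \<open>A graph on a vertex set is given by its symmetric, irreflexive adjacency relation.\<close>

definition intersection_graph :: "('v \<times> 'a) set \<Rightarrow> ('v \<times> 'v) set" where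
  "intersection_graph B = {(u, v). u \<noteq> v \<and> (\<exists>a. (u, a) \<in> B \<and> (v, a) \<in> B)}"

definition random_intersection_graph ::
    "nat \<Rightarrow> nat \<Rightarrow> (nat \<Rightarrow> real) \<Rightarrow> (nat \<times> nat) set pmf" where
  "random_intersection_graph n m p = map_pmf intersection_graph (random_bipartite n m p)"

text \<open>
  For a symmetric \<open>E \<subseteq> V \<times> V\<close>, the relation \<open>E\<^sup>*\<close> restricts to an equivalence relation on \<open>V\<close>,
  and the class of a vertex of \<open>V\<close> stays inside \<open>V\<close>. Isolated vertices form singleton components.
\<close>

definition graph_components :: "'v set \<Rightarrow> ('v \<times> 'v) set \<Rightarrow> 'v set set" where
  "graph_components V E = V // E\<^sup>*"

definition max_prob :: "nat \<Rightarrow> (nat \<Rightarrow> real) \<Rightarrow> real" where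
  "max_prob m p = Max (p ` {..<m})"

definition extinction_fun :: "nat \<Rightarrow> nat \<Rightarrow> (nat \<Rightarrow> real) \<Rightarrow> real \<Rightarrow> real" where
  "extinction_fun n m p x = (\<Prod>i<m. 1 - p i * (1 - (1 - p i * (1 - x)) ^ n))"

end

theory Submission
  imports Defs "HOL-Probability.Hoeffding" "HOL-Real_Asymp.Real_Asymp"
begin

text \<open>
  Explore the graph one vertex at a time, always continuing from a discovered vertex if there is one.
  The incidences can be read off from two independent copies \<open>R\<close>, \<open>I\<close> of the bipartite graph: the
  \<open>t\<close>-th explored vertex finds its new attributes in row \<open>t\<close> of \<open>R\<close>, and a vertex \<open>x\<close> is discovered by
  time \<open>t\<close> if row \<open>x\<close> of \<open>I\<close> meets the rows of \<open>R\<close> before \<open>t\<close>. The set \<open>D t\<close> of these vertices no longer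
  depends on the order of exploration. Given \<open>R\<close>, its size is binomial, and its mean is within a
  constant of \<open>n * (1 - f (1 - t / n))\<close>, where \<open>f\<close> is the extinction function. Components
  correspond to the stretches between consecutive times at which \<open>D t\<close> is contained in the explored set.

  The function \<open>f\<close> is convex with slope \<open>c > 1\<close> at its fixed point \<open>1\<close>. Hence the expected surplus
  of \<open>card (D t)\<close> over \<open>t\<close> is concave, of order \<open>t\<close> initially, and it vanishes at \<open>(1 - \<rho>) * n\<close>.
  In between it is at least of order \<open>min n (1 / p)\<close>, which dominates the fluctuations of order
  \<open>sqrt n\<close> because \<open>\<gamma> > 1 / 2\<close>. So, from any starting vertex, with probability
  \<open>1 - O(1 / n\<^sup>2)\<close> no component is completed between the times \<open>K * max (n * p) 1 * ln n\<close> and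
  \<open>(1 - \<epsilon>) * (1 - \<rho>) * n\<close>, and every component is small or giant. A giant one ends by
  \<open>(1 + \<epsilon>) * (1 - \<rho>) * n\<close>, and afterwards \<open>card (D t)\<close> grows too slowly for a second one.
\<close>

section \<open>Hitting events of a random bipartite graph\<close>

lemma random_bipartite_subset:
  "B \<in> set_pmf (random_bipartite n m p) \<Longrightarrow> B \<subseteq> {..<n} \<times> {..<m}"
  using set_Pi_pmf_subset[of "{..<n} \<times> {..<m}" False "\<lambda>(v, i). bernoulli_pmf (p i)"]
  by (fastforce simp: random_bipartite_def)

lemma prob_random_bipartite_agree:
  assumes p: "\<And>i. i < m \<Longrightarrow> 0 \<le> p i \<and> p i \<le> 1" and S: "S \<subseteq> {..<n} \<times> {..<m}"
  shows "measure_pmf.prob (random_bipartite n m p) {B. \<forall>e\<in>S. e \<in> B \<longleftrightarrow> e \<in> J}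
           = (\<Prod>e\<in>S. if e \<in> J then p (snd e) else 1 - p (snd e))"
proof -
  let ?A = "{..<n} \<times> {..<m}"
  define T where "T = (\<lambda>e. if e \<in> S then {e \<in> J} else UNIV)"
  have "Collect -` {B. \<forall>e\<in>S. e \<in> B \<longleftrightarrow> e \<in> J} = Pi ?A T"
    using S by (fastforce simp: T_def Pi_def split: if_splits)
  then have "measure_pmf.prob (random_bipartite n m p) {B. \<forall>e\<in>S. e \<in> B \<longleftrightarrow> e \<in> J}
      = measure_pmf.prob (Pi_pmf ?A False (\<lambda>(v, i). bernoulli_pmf (p i))) (Pi ?A T)"
    by (simp add: random_bipartite_def)
  also have "\<dots> = (\<Prod>e\<in>?A. measure_pmf.prob (case e of (v, i) \<Rightarrow> bernoulli_pmf (p i)) (T e))"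
    by (rule measure_Pi_pmf_Pi) auto
  also have "\<dots> = (\<Prod>e\<in>S. measure_pmf.prob (case e of (v, i) \<Rightarrow> bernoulli_pmf (p i)) (T e))"
    using S by (intro prod.mono_neutral_right) (auto simp: T_def)
  also have "\<dots> = (\<Prod>e\<in>S. if e \<in> J then p (snd e) else 1 - p (snd e))"
  proof (rule prod.cong)
    fix e assume e: "e \<in> S"
    obtain v i where [simp]: "e = (v, i)" by force
    have "0 \<le> p i" "p i \<le> 1" using p[of i] S e by auto
    then show "measure_pmf.prob (case e of (v, i) \<Rightarrow> bernoulli_pmf (p i)) (T e)
        = (if e \<in> J then p (snd e) else 1 - p (snd e))"
      using e by (auto simp: T_def measure_pmf_single)
  qed simp
  finally show ?thesis .
qed

lemma prob_random_bipartite_avoid: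
  assumes "\<And>i. i < m \<Longrightarrow> 0 \<le> p i \<and> p i \<le> 1" and "S \<subseteq> {..<n} \<times> {..<m}"
  shows "measure_pmf.prob (random_bipartite n m p) {B. B \<inter> S = {}} = (\<Prod>e\<in>S. 1 - p (snd e))"
proof -
  have "{B. B \<inter> S = {}} = {B. \<forall>e\<in>S. e \<in> B \<longleftrightarrow> e \<in> {}}" by auto
  then show ?thesis
    using prob_random_bipartite_agree[OF assms, where J = "{}"] by simp
qed

text \<open>The sigma-algebra generated by \<open>X i\<close> is contained in the one generated by
  the single event \<open>F i\<close>, so independence passes from the events to the
  variables.\<close>

lemma (in prob_space) indep_vars_two_valued:
  fixes X :: "'i \<Rightarrow> 'a \<Rightarrow> real"
  assumes ind: "indep_events F I" and X: "\<And>i. i \<in> I \<Longrightarrow> X i = (\<lambda>x. if x \<in> F i then a i else b i)"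
  shows "indep_vars (\<lambda>_. borel) X I"
proof -
  have ev: "F i \<in> events" if "i \<in> I" for i
    using ind that by (auto simp: indep_events_def)
  have "indep_sets (\<lambda>i. sigma_sets (space M) {F i}) I"
    by (rule indep_sets_sigma) (use ind in \<open>auto simp: indep_events_def_alt Int_stable_def\<close>)
  then have "indep_sets (\<lambda>i. {X i -` A \<inter> space M | A. A \<in> sets borel}) I"
  proof (rule indep_sets_mono_sets)
    fix i assume i: "i \<in> I"
    have F: "F i \<in> sigma_sets (space M) {F i}" by auto
    have C: "space M - F i \<in> sigma_sets (space M) {F i}" by (intro sigma_sets.Compl F)
    have *: "X i -` A \<inter> space M \<in> sigma_sets (space M) {F i}" for A
    proof -
      have "F i \<subseteq> space M" using ev[OF i] sets.sets_into_space by blast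
      then consider "X i -` A \<inter> space M = {}" | "X i -` A \<inter> space M = F i"
        | "X i -` A \<inter> space M = space M - F i" | "X i -` A \<inter> space M = space M"
        by (cases "a i \<in> A"; cases "b i \<in> A") (auto simp: X[OF i] split: if_splits)
      then show ?thesis
        by cases (use F C sigma_sets_top in \<open>auto intro: sigma_sets.Empty\<close>)
    qed
    then show "{X i -` A \<inter> space M |A. A \<in> sets borel} \<subseteq> sigma_sets (space M) {F i}"
      by auto
  qed
  moreover have "random_variable borel (X i)" if "i \<in> I" for i
    using ev[OF that] by (subst X[OF that]) (intro measurable_If_set, auto)
  ultimately show ?thesis
    unfolding indep_vars_def2 by auto
qed

text \<open>Avoiding several cell sets means avoiding their union, and over disjoint sets the
  product of the \<open>1 - p (snd e)\<close> factorizes.\<close>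

lemma indep_events_random_bipartite_avoid:
  assumes p: "\<And>i. i < m \<Longrightarrow> 0 \<le> p i \<and> p i \<le> 1"
    and S: "\<And>k. k \<in> A \<Longrightarrow> S k \<subseteq> {..<n} \<times> {..<m}" and disj: "disjoint_family_on S A"
  shows "prob_space.indep_events (measure_pmf (random_bipartite n m p)) (\<lambda>k. {B. B \<inter> S k = {}}) A"
proof (rule prob_space.indep_eventsI[OF measure_pmf.prob_space_axioms])
  fix J assume J: "J \<subseteq> A" "finite J"
  have fin: "finite (S k)" if "k \<in> A" for k
    using S[OF that] by (rule finite_subset) auto
  have eq: "(\<Inter>k\<in>J. {B. B \<inter> S k = {}}) = {B. B \<inter> (\<Union>k\<in>J. S k) = {}}" by auto
  have "measure_pmf.prob (random_bipartite n m p) {B. B \<inter> (\<Union>k\<in>J. S k) = {}}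
      = (\<Prod>e\<in>(\<Union>k\<in>J. S k). 1 - p (snd e))"
    by (rule prob_random_bipartite_avoid) (use p S J in auto)
  also have "\<dots> = (\<Prod>k\<in>J. \<Prod>e\<in>S k. 1 - p (snd e))"
    by (rule prod.UNION_disjoint)
      (use J fin in \<open>auto simp: subset_iff dest!: disjoint_family_onD[OF disj]\<close>)
  also have "\<dots> = (\<Prod>k\<in>J. measure_pmf.prob (random_bipartite n m p) {B. B \<inter> S k = {}})"
    by (intro prod.cong prob_random_bipartite_avoid[symmetric]) (use p S J in auto)
  finally show "measure_pmf.prob (random_bipartite n m p) (\<Inter>k\<in>J. {B. B \<inter> S k = {}})
      = (\<Prod>k\<in>J. measure_pmf.prob (random_bipartite n m p) {B. B \<inter> S k = {}})"
    unfolding eq .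
qed auto

text \<open>One statistic serves both stages of the exploration. With columns
  \<open>{..<t} \<times> {i}\<close> as cell sets it weighs the attributes found by time
  \<open>t\<close>; with rows \<open>{x} \<times> U\<close> and constant weights it counts the
  vertices that meet the attribute set \<open>U\<close>.\<close>

definition hit_sum :: "'k set \<Rightarrow> ('k \<Rightarrow> (nat \<times> nat) set) \<Rightarrow> ('k \<Rightarrow> real) \<Rightarrow> (nat \<times> nat) set \<Rightarrow> real" where
  "hit_sum A S a B = (\<Sum>k\<in>A. if B \<inter> S k = {} then 0 else a k)"

lemma expectation_two_valued:
  "measure_pmf.expectation M (\<lambda>x. if x \<in> F then a else b)
     = (1 - measure_pmf.prob M F) * b + measure_pmf.prob M F * (a :: real)"
proof -
  have "(\<lambda>x. if x \<in> F then a else b) = (\<lambda>x. (a - b) * indicator F x + b)"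
    by (auto simp: indicator_def)
  moreover have "integrable (measure_pmf M) (\<lambda>x. indicator F x :: real)"
    by (rule measure_pmf.integrable_const_bound[where B = 1]) (auto simp: indicator_def)
  ultimately have "measure_pmf.expectation M (\<lambda>x. if x \<in> F then a else b)
      = (a - b) * measure_pmf.prob M F + b"
    by simp
  then show ?thesis by (simp add: algebra_simps)
qed

text \<open>Chernoff's method: Markov's inequality for \<open>exp (- hit_sum A S a B)\<close>,
  independence of the summands, and \<open>1 - y \<le> exp (- y)\<close>. The exponential parameter
  is absorbed into the weights \<open>a\<close>.\<close>

lemma hit_sum_lower_tail:
  fixes a :: "'k \<Rightarrow> real"
  assumes p: "\<And>i. i < m \<Longrightarrow> 0 \<le> p i \<and> p i \<le> 1" and A: "finite A"
    and S: "\<And>k. k \<in> A \<Longrightarrow> S k \<subseteq> {..<n} \<times> {..<m}" and disj: "disjoint_family_on S A"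
  defines "q \<equiv> \<lambda>k. 1 - (\<Prod>e\<in>S k. 1 - p (snd e))"
  shows "measure_pmf.prob (random_bipartite n m p) {B. hit_sum A S a B \<le> s}
           \<le> exp (s - (\<Sum>k\<in>A. q k * (1 - exp (- a k))))"
proof -
  let ?M = "random_bipartite n m p"
  define X where "X = (\<lambda>k B. if B \<in> {B. B \<inter> S k = {}} then 1 else exp (- a k))"
  have ind: "prob_space.indep_vars (measure_pmf ?M) (\<lambda>_. borel) X A"
  proof (rule measure_pmf.indep_vars_two_valued)
    show "prob_space.indep_events (measure_pmf ?M) (\<lambda>k. {B. B \<inter> S k = {}}) A"
      by (rule indep_events_random_bipartite_avoid) (use p S disj in auto)
  qed (simp add: X_def)
  have bX: "\<bar>X k B\<bar> \<le> max 1 (exp (- a k))" for k B by (auto simp: X_def)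
  have intX: "integrable (measure_pmf ?M) (X k)" for k
    by (rule measure_pmf.integrable_const_bound[where B = "max 1 (exp (- a k))"])
      (use bX in auto)
  have EX: "measure_pmf.expectation ?M (X k) = 1 - q k * (1 - exp (- a k))" if "k \<in> A" for k
    unfolding X_def expectation_two_valued
    using prob_random_bipartite_avoid[OF p S[OF that]] by (simp add: q_def algebra_simps)
  have prodX: "(\<Prod>k\<in>A. X k B) = exp (- hit_sum A S a B)" for B
    unfolding hit_sum_def sum_negf[symmetric] using A
    by (subst exp_sum) (auto intro!: prod.cong simp: X_def)
  have "measure_pmf.prob ?M {B. hit_sum A S a B \<le> s} \<le> measure_pmf.expectation ?M (\<lambda>B. exp s * (\<Prod>k\<in>A. X k B))"
  proof -
    have "measure_pmf.prob ?M {B. hit_sum A S a B \<le> s} = measure_pmf.expectation ?M (indicator {B. hit_sum A S a B \<le> s})"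
      by simp
    also have "\<dots> \<le> measure_pmf.expectation ?M (\<lambda>B. exp s * (\<Prod>k\<in>A. X k B))"
    proof (intro integral_mono)
      show "integrable (measure_pmf ?M) (\<lambda>B. exp s * (\<Prod>k\<in>A. X k B))"
        by (intro integrable_mult_right prob_space.indep_vars_integrable[OF measure_pmf.prob_space_axioms A ind intX])
      show "indicator {B. hit_sum A S a B \<le> s} B \<le> exp s * (\<Prod>k\<in>A. X k B)" for B
        by (auto simp: indicator_def prodX simp flip: exp_add)
    qed (auto intro!: measure_pmf.integrable_const_bound[where B = 1])
    finally show ?thesis .
  qed
  also have "\<dots> = exp s * (\<Prod>k\<in>A. 1 - q k * (1 - exp (- a k)))"
    using prob_space.indep_vars_lebesgue_integral[OF measure_pmf.prob_space_axioms A ind intX] EX by simp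
  also have "\<dots> \<le> exp s * (\<Prod>k\<in>A. exp (- (q k * (1 - exp (- a k)))))"
  proof (intro mult_left_mono prod_mono conjI)
    fix k assume k: "k \<in> A"
    show "0 \<le> 1 - q k * (1 - exp (- a k))"
      using EX[OF k] Bochner_Integration.integral_nonneg[of "measure_pmf ?M" "X k"]
      by (auto simp: X_def)
    show "1 - q k * (1 - exp (- a k)) \<le> exp (- (q k * (1 - exp (- a k))))"
      using exp_ge_add_one_self[of "- (q k * (1 - exp (- a k)))"] by simp
  qed auto
  also have "\<dots> = exp (s - (\<Sum>k\<in>A. q k * (1 - exp (- a k))))"
    using A by (simp add: exp_sum[symmetric] sum_negf flip: exp_add)
  finally show ?thesis .
qed

lemma hit_sum_Hoeffding:
  fixes a :: "'k \<Rightarrow> real"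
  assumes p: "\<And>i. i < m \<Longrightarrow> 0 \<le> p i \<and> p i \<le> 1" and A: "finite A"
    and S: "\<And>k. k \<in> A \<Longrightarrow> S k \<subseteq> {..<n} \<times> {..<m}" and disj: "disjoint_family_on S A"
    and a: "\<And>k. k \<in> A \<Longrightarrow> 0 \<le> a k" and pos: "(\<Sum>k\<in>A. (a k)\<^sup>2) > 0" and y: "y \<ge> 0"
  defines "q \<equiv> \<lambda>k. 1 - (\<Prod>e\<in>S k. 1 - p (snd e))"
  shows "measure_pmf.prob (random_bipartite n m p)
            {B. \<bar>hit_sum A S a B - (\<Sum>k\<in>A. q k * a k)\<bar> \<ge> y}
           \<le> 2 * exp (- 2 * y\<^sup>2 / (\<Sum>k\<in>A. (a k)\<^sup>2))"
proof -
  let ?M = "random_bipartite n m p"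
  define X where "X = (\<lambda>k B. if B \<in> {B. B \<inter> S k = {}} then 0 else a k)"
  have ind: "prob_space.indep_vars (measure_pmf ?M) (\<lambda>_. borel) X A"
  proof (rule measure_pmf.indep_vars_two_valued)
    show "prob_space.indep_events (measure_pmf ?M) (\<lambda>k. {B. B \<inter> S k = {}}) A"
      by (rule indep_events_random_bipartite_avoid) (use p S disj in auto)
  qed (simp add: X_def)
  have EX: "measure_pmf.expectation ?M (X k) = q k * a k" if "k \<in> A" for k
    unfolding X_def expectation_two_valued
    using prob_random_bipartite_avoid[OF p S[OF that]] by (simp add: q_def algebra_simps)
  interpret H: Hoeffding_ineq "measure_pmf ?M" A X "\<lambda>_. 0" a "\<Sum>k\<in>A. q k * a k"
  proof unfold_locales
    show "(\<Sum>k\<in>A. q k * a k) \<equiv> (\<Sum>k\<in>A. measure_pmf.expectation ?M (X k))"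
      by (rule eq_reflection) (simp add: EX)
  qed (use A ind a in \<open>auto simp: X_def\<close>)
  show ?thesis
    using H.Hoeffding_ineq_abs_ge[OF y] pos by (simp add: hit_sum_def X_def)
qed

section \<open>Independent pairs and conditioning on the first copy\<close>

lemma prob_pair_pmf:
  "measure_pmf.prob (pair_pmf M N) Q
     = measure_pmf.expectation M (\<lambda>x. measure_pmf.prob N {y. (x, y) \<in> Q})"
proof -
  have eq: "pair_pmf M N = bind_pmf M (\<lambda>x. map_pmf (Pair x) N)"
    by (simp add: pair_pmf_def map_pmf_def)
  show ?thesis
    unfolding eq measure_pmf_bind
    by (subst measure_pmf.measure_bind[where N = "count_space UNIV"])
      (auto simp: vimage_def measurable_def space_subprob_algebra
        intro: measure_pmf.subprob_space_axioms)
qed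

lemma prob_pair_pmf_Times:
  "measure_pmf.prob (pair_pmf M N) (A \<times> B) = measure_pmf.prob M A * measure_pmf.prob N B"
proof -
  have "(\<lambda>x. measure_pmf.prob N {y. (x, y) \<in> A \<times> B}) = (\<lambda>x. indicator A x * measure_pmf.prob N B)"
    by (auto simp: indicator_def)
  then show ?thesis by (simp add: prob_pair_pmf)
qed

lemma prob_pair_pmf_le:
  assumes "measure_pmf.prob M A \<le> \<alpha>" and "0 \<le> \<beta>"
    and "\<And>x. x \<in> set_pmf M \<Longrightarrow> x \<notin> A \<Longrightarrow> measure_pmf.prob N {y. (x, y) \<in> Q} \<le> \<beta>"
  shows "measure_pmf.prob (pair_pmf M N) Q \<le> \<alpha> + \<beta>"
proof -
  have int: "integrable (measure_pmf M) f" if "\<And>x. 0 \<le> f x \<and> f x \<le> B" for f :: "_ \<Rightarrow> real" and B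
    by (rule measure_pmf.integrable_const_bound[where B = B]) (use that in auto)
  have "measure_pmf.prob (pair_pmf M N) Q
      = measure_pmf.expectation M (\<lambda>x. measure_pmf.prob N {y. (x, y) \<in> Q})"
    by (rule prob_pair_pmf)
  also have "\<dots> \<le> measure_pmf.expectation M (\<lambda>x. indicator A x + \<beta>)"
  proof (rule integral_mono_AE)
    show "AE x in measure_pmf M. measure_pmf.prob N {y. (x, y) \<in> Q} \<le> indicator A x + \<beta>"
      using assms(2,3) 
      by (auto simp: AE_measure_pmf_iff indicator_def intro: order_trans[OF measure_pmf.prob_le_1])
    show "integrable (measure_pmf M) (\<lambda>x. indicator A x + \<beta>)"
      by (rule int[where B = "1 + \<beta>"]) (use assms(2) in \<open>auto simp: indicator_def\<close>)
    show "integrable (measure_pmf M) (\<lambda>x. measure_pmf.prob N {y. (x, y) \<in> Q})"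
      by (rule int[where B = 1]) auto
  qed
  also have "\<dots> = measure_pmf.prob M A + \<beta>"
    by (subst Bochner_Integration.integral_add) (auto intro!: int[where B = 1] simp: indicator_def)
  finally show ?thesis using assms(1) by simp
qed

section \<open>Exploration with two independent copies\<close>

text \<open>An empty \<open>A\<close> means that the current component is exhausted and a new one is
  begun. The rule \<open>pick\<close> stays arbitrary so that the first vertex can be prescribed
  later.\<close>

definition next_vertex :: "(nat set \<Rightarrow> nat) \<Rightarrow> nat \<Rightarrow> (nat \<times> nat) set \<Rightarrow> nat set \<Rightarrow> nat set \<Rightarrow> nat" where
  "next_vertex pick n I U W =
     (let A = {x \<in> {..<n} - W. I `` {x} \<inter> U \<noteq> {}} in pick (if A = {} then {..<n} - W else A))"

text \<open>
  \<open>u t W\<close> is the set of attributes revealed by the first \<open>t\<close> steps, which explored the vertices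
  \<open>W\<close>. With \<open>u t W = B `` W\<close> and \<open>I = B\<close> this is the usual exploration of the bipartite graph \<open>B\<close>.
\<close>

primrec explored :: "(nat set \<Rightarrow> nat) \<Rightarrow> nat \<Rightarrow> (nat \<times> nat) set \<Rightarrow> (nat \<Rightarrow> nat set \<Rightarrow> nat set) \<Rightarrow>
    nat \<Rightarrow> nat set" where
  "explored pick n I u 0 = {}"
| "explored pick n I u (Suc t) =
     insert (next_vertex pick n I (u t (explored pick n I u t)) (explored pick n I u t))
       (explored pick n I u t)"

definition visit :: "(nat set \<Rightarrow> nat) \<Rightarrow> nat \<Rightarrow> (nat \<times> nat) set \<Rightarrow> (nat \<Rightarrow> nat set \<Rightarrow> nat set) \<Rightarrow>
    nat \<Rightarrow> nat" where
  "visit pick n I u t = next_vertex pick n I (u t (explored pick n I u t)) (explored pick n I u t)"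

lemma explored_Suc [simp]: "explored pick n I u (Suc t) = insert (visit pick n I u t) (explored pick n I u t)"
  by (simp add: visit_def)

declare explored.simps(2) [simp del]

lemma explored_conv_visit: "explored pick n I u t = visit pick n I u ` {..<t}"
  by (induction t) (auto simp: lessThan_Suc)

text \<open>A step sees the incidences only through the traces of unexplored rows on the attributes
  revealed so far. Two runs with equal traces along the first run, and with revealed sets that
  evolve alike, therefore coincide.\<close>

lemma explored_runs_agree:
  assumes I: "\<And>t x. t < n \<Longrightarrow> x < n \<Longrightarrow> x \<notin> explored pick n I u t \<Longrightarrow>
        I `` {x} \<inter> u t (explored pick n I u t) = I' `` {x} \<inter> u t (explored pick n I u t)"
    and u0: "u' 0 {} = u 0 {}"
    and u: "\<And>t. t < n \<Longrightarrow> u' t (explored pick n I u t) = u t (explored pick n I u t) \<Longrightarrow>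
        u' (Suc t) (explored pick n I u (Suc t)) = u (Suc t) (explored pick n I u (Suc t))"
    and t: "t \<le> n"
  shows "explored pick n I' u' t = explored pick n I u t \<and>
         u' t (explored pick n I u t) = u t (explored pick n I u t)"
  using t
proof (induction t)
  case 0
  then show ?case using u0 by simp
next
  case (Suc t)
  let ?W = "explored pick n I u t" and ?U = "u t (explored pick n I u t)"
  have IH: "explored pick n I' u' t = ?W" "u' t ?W = ?U" using Suc by auto
  have "{x \<in> {..<n} - ?W. I' `` {x} \<inter> ?U \<noteq> {}} = {x \<in> {..<n} - ?W. I `` {x} \<inter> ?U \<noteq> {}}"
    using I[of t] Suc.prems by auto
  then have "visit pick n I' u' t = visit pick n I u t"
    unfolding visit_def next_vertex_def IH by simp
  then show ?case
    using IH u[of t] Suc.prems by simp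
qed

locale selection =
  fixes pick :: "nat set \<Rightarrow> nat"
  assumes pick: "X \<noteq> {} \<Longrightarrow> pick X \<in> X"
begin

lemma next_vertex:
  assumes "\<not> {..<n} \<subseteq> W"
  shows "next_vertex pick n I U W \<in> {..<n} - W"
proof -
  define A where "A = {x \<in> {..<n} - W. I `` {x} \<inter> U \<noteq> {}}"
  have "pick (if A = {} then {..<n} - W else A) \<in> (if A = {} then {..<n} - W else A)"
    using assms by (intro pick) auto
  also have "\<dots> \<subseteq> {..<n} - W" by (auto simp: A_def)
  finally show ?thesis unfolding next_vertex_def A_def Let_def .
qed

lemma explored_props: "t \<le> n \<Longrightarrow> explored pick n I u t \<subseteq> {..<n} \<and> card (explored pick n I u t) = t"
proof (induction t)
  case (Suc t)
  let ?W = "explored pick n I u t"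
  have W: "?W \<subseteq> {..<n}" "card ?W = t" using Suc by auto
  have "\<not> {..<n} \<subseteq> ?W"
    using card_mono[of ?W "{..<n}"] finite_subset[OF W(1)] W(2) Suc.prems by auto
  then have "visit pick n I u t \<in> {..<n} - ?W"
    unfolding visit_def by (rule next_vertex)
  then show ?case using W finite_subset[OF W(1)] by simp
qed simp

lemma visit: "t < n \<Longrightarrow> visit pick n I u t \<in> {..<n} - explored pick n I u t"
proof -
  assume t: "t < n"
  let ?W = "explored pick n I u t"
  have W: "?W \<subseteq> {..<n}" "card ?W = t" using explored_props[of t n I u] t by auto
  have "\<not> {..<n} \<subseteq> ?W"
    using card_mono[of ?W "{..<n}"] finite_subset[OF W(1)] W(2) t by auto
  then show ?thesis unfolding visit_def by (rule next_vertex)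
qed

lemma inj_on_visit: "inj_on (visit pick n I u) {..<n}"
proof (rule linorder_inj_onI)
  fix s t assume "s < t" "s \<in> {..<n}" "t \<in> {..<n}"
  then show "visit pick n I u s \<noteq> visit pick n I u t"
    using visit[of t n I u] by (metis DiffE explored_conv_visit imageI lessThan_iff)
qed auto

lemma visit_image: "visit pick n I u ` {..<n} = {..<n}"
  using explored_props[of n n I u] card_subset_eq[of "{..<n}" "explored pick n I u n"]
  by (auto simp: explored_conv_visit)

lemma visit_in_explored_iff:
  "t \<le> n \<Longrightarrow> j < n \<Longrightarrow> visit pick n I u j \<in> explored pick n I u t \<longleftrightarrow> j < t"
  using inj_on_visit[of n I u]
  by (simp add: explored_conv_visit inj_on_image_mem_iff[where B = "{..<n}"])

lemma visitE:
  assumes "x < n"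
  obtains t where "t < n" "x = visit pick n I u t"
  using assms visit_image[of n I u] by (metis imageE lessThan_iff)

end

text \<open>
  The vertex explored at time \<open>t\<close> takes its incidences with the attributes found earlier from \<open>I\<close>
  and those with all other attributes from row \<open>t\<close> of \<open>R\<close>. Every incidence of the merged graph
  is thus read off exactly once from an entry of \<open>R\<close> or \<open>I\<close>, so its law does not change.
\<close>

definition merged_graph :: "(nat set \<Rightarrow> nat) \<Rightarrow> nat \<Rightarrow> (nat \<times> nat) set \<Rightarrow> (nat \<times> nat) set \<Rightarrow> (nat \<times> nat) set" where
  "merged_graph pick n R I = {(x, i). \<exists>t<n. x = visit pick n I (\<lambda>t _. R `` {..<t}) t \<and>
     (if i \<in> R `` {..<t} then (x, i) \<in> I else (t, i) \<in> R)}"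

context selection
begin

lemma merged_graph_visit_iff:
  assumes "t < n"
  shows "(visit pick n I (\<lambda>t _. R `` {..<t}) t, i) \<in> merged_graph pick n R I \<longleftrightarrow>
     (if i \<in> R `` {..<t} then (visit pick n I (\<lambda>t _. R `` {..<t}) t, i) \<in> I else (t, i) \<in> R)"
proof -
  have "s = t" if "s < n" "visit pick n I (\<lambda>t _. R `` {..<t}) t = visit pick n I (\<lambda>t _. R `` {..<t}) s" for s
    using inj_on_visit[of n I "\<lambda>t _. R `` {..<t}"] that assms by (auto simp: inj_on_def)
  then show ?thesis using assms by (auto simp: merged_graph_def)
qed

lemma merged_graph_subset:
  assumes "R \<subseteq> {..<n} \<times> {..<m}" "I \<subseteq> {..<n} \<times> {..<m}"
  shows "merged_graph pick n R I \<subseteq> {..<n} \<times> {..<m}"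
proof (intro subsetI, clarify)
  fix x i assume "(x, i) \<in> merged_graph pick n R I"
  then obtain t where "t < n" "x = visit pick n I (\<lambda>t _. R `` {..<t}) t"
    and *: "if i \<in> R `` {..<t} then (x, i) \<in> I else (t, i) \<in> R"
    by (auto simp: merged_graph_def)
  then show "x \<in> {..<n} \<and> i \<in> {..<m}"
    using visit[of t n I "\<lambda>t _. R `` {..<t}"] assms by (auto split: if_splits)
qed

lemma explored_merged_graph:
  assumes t: "t \<le> n"
  shows "explored pick n (merged_graph pick n R I) (\<lambda>_ W. merged_graph pick n R I `` W) t =
         explored pick n I (\<lambda>t _. R `` {..<t}) t \<and>
         merged_graph pick n R I `` explored pick n I (\<lambda>t _. R `` {..<t}) t = R `` {..<t}"
proof (rule explored_runs_agree[where u' = "\<lambda>_ W. merged_graph pick n R I `` W" and u = "\<lambda>t _. R `` {..<t}", OF _ _ _ t])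
  let ?B = "merged_graph pick n R I" and ?u = "\<lambda>t _. R `` {..<t}"
  fix t x assume t: "t < n" and x: "x < n" "x \<notin> explored pick n I ?u t"
  obtain s where s: "s < n" "x = visit pick n I ?u s" using visitE[OF x(1)] by metis
  \<comment> \<open>An unexplored vertex gets its turn at some time \<open>s \<ge> t\<close>, when
    every attribute found before \<open>t\<close> counts as old; the merged graph therefore reads
    these incidences from \<open>I\<close>.\<close>
  have "s \<ge> t" using x s t visit_in_explored_iff[of t n s I ?u] by auto
  then have "R `` {..<t} \<subseteq> R `` {..<s}" by auto
  then have "i \<in> I `` {x} \<inter> R `` {..<t} \<longleftrightarrow> i \<in> ?B `` {x} \<inter> R `` {..<t}" for i
    using merged_graph_visit_iff[OF s(1), of I R i] unfolding s(2)
    by (cases "i \<in> R `` {..<t}") (simp_all add: subsetD)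
  then show "I `` {x} \<inter> R `` {..<t} = ?B `` {x} \<inter> R `` {..<t}" by blast
next
  let ?B = "merged_graph pick n R I" and ?u = "\<lambda>t _. R `` {..<t}"
  fix t assume t: "t < n" and IH: "?B `` explored pick n I ?u t = R `` {..<t}"
  have "?B `` explored pick n I ?u (Suc t) = R `` {..<t} \<union> ?B `` {visit pick n I ?u t}"
    using IH by auto
  also have "\<dots> = R `` {..<t} \<union> R `` {t}"
    using merged_graph_visit_iff[OF t, of I R] by auto
  also have "\<dots> = R `` {..<Suc t}" by (auto simp: lessThan_Suc)
  finally show "?B `` explored pick n I ?u (Suc t) = R `` {..<Suc t}" .
qed auto

text \<open>The right-hand side runs the exploration on the fixed graph \<open>J\<close> alone. The
  fibre over \<open>J\<close> is thereby described by prescribing entries of \<open>R\<close> and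
  \<open>I\<close> at cells that do not depend on \<open>R\<close> and \<open>I\<close>.\<close>

lemma merged_graph_eq_iff:
  assumes R: "R \<subseteq> {..<n} \<times> {..<m}" and I: "I \<subseteq> {..<n} \<times> {..<m}" and J: "J \<subseteq> {..<n} \<times> {..<m}"
  defines "W \<equiv> explored pick n J (\<lambda>_ W. J `` W)" and "w \<equiv> visit pick n J (\<lambda>_ W. J `` W)"
  shows "merged_graph pick n R I = J \<longleftrightarrow>
    (\<forall>t<n. \<forall>i<m. if i \<in> J `` W t then (w t, i) \<in> I \<longleftrightarrow> (w t, i) \<in> J else (t, i) \<in> R \<longleftrightarrow> (w t, i) \<in> J)"
proof
  let ?u = "\<lambda>t _. R `` {..<t}"
  assume eq: "merged_graph pick n R I = J"
  have W: "W t = explored pick n I ?u t" and U: "J `` W t = R `` {..<t}" if "t \<le> n" for t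
    using explored_merged_graph[OF that, of R I] unfolding W_def eq by auto
  have w: "w t = visit pick n I ?u t" if "t < n" for t
  proof -
    have "{w t} = W (Suc t) - W t"
      using visit[OF that, of J "\<lambda>_ W. J `` W"] by (auto simp: W_def w_def)
    also have "\<dots> = {visit pick n I ?u t}"
      using visit[OF that, of I ?u] that by (auto simp: W)
    finally show ?thesis by simp
  qed
  show "\<forall>t<n. \<forall>i<m. if i \<in> J `` W t then (w t, i) \<in> I \<longleftrightarrow> (w t, i) \<in> J else (t, i) \<in> R \<longleftrightarrow> (w t, i) \<in> J"
    using merged_graph_visit_iff[of _ n I R] unfolding eq by (auto simp: w U)
next
  let ?u = "\<lambda>t _. R `` {..<t}" and ?uJ = "\<lambda>_ W. J `` W"
  assume *: "\<forall>t<n. \<forall>i<m. if i \<in> J `` W t then (w t, i) \<in> I \<longleftrightarrow> (w t, i) \<in> J else (t, i) \<in> R \<longleftrightarrow> (w t, i) \<in> J"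
  have mono: "W s \<subseteq> W t" if "s \<le> t" for s t
    using that by (auto simp: W_def explored_conv_visit)
  have run: "explored pick n I ?u t = W t \<and> R `` {..<t} = J `` W t" if t: "t \<le> n" for t
    unfolding W_def
  proof (rule explored_runs_agree[where u' = ?u and u = ?uJ, OF _ _ _ t])
    fix t x assume t: "t < n" and x: "x < n" "x \<notin> explored pick n J ?uJ t"
    obtain s where s: "s < n" "x = w s" using visitE[OF x(1)] unfolding w_def by metis
    have "s \<ge> t" using x s t visit_in_explored_iff[of t n s J ?uJ] by (auto simp: w_def)
    then have "J `` W t \<subseteq> J `` W s" using mono by blast
    moreover have "J `` W t \<subseteq> {..<m}" using J by auto
    ultimately have "i \<in> J `` {x} \<inter> J `` W t \<longleftrightarrow> i \<in> I `` {x} \<inter> J `` W t" for i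
      using *[rule_format, OF s(1), of i] unfolding s(2)
      by (cases "i \<in> J `` W t") (simp_all add: subset_eq Ball_def)
    then show "J `` {x} \<inter> J `` explored pick n J ?uJ t = I `` {x} \<inter> J `` explored pick n J ?uJ t"
      unfolding W_def by blast
  next
    fix t assume t: "t < n" and IH: "R `` {..<t} = J `` explored pick n J ?uJ t"
    have "R `` {..<Suc t} = J `` W t \<union> R `` {t}"
      using IH by (auto simp: lessThan_Suc W_def)
    also have "\<dots> = J `` W t \<union> J `` {w t}"
    proof -
      have "i \<in> R `` {t} \<longleftrightarrow> i \<in> J `` {w t}" if "i \<notin> J `` W t" for i
        using * t that R J by (cases "i < m") auto
      then show ?thesis by blast
    qed
    also have "\<dots> = J `` W (Suc t)" by (auto simp: W_def w_def)
    finally show "R `` {..<Suc t} = J `` explored pick n J ?uJ (Suc t)" by (simp add: W_def)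
  qed auto
  have w: "w t = visit pick n I ?u t" if "t < n" for t
  proof -
    have "{w t} = W (Suc t) - W t"
      using visit[OF that, of J "\<lambda>_ W. J `` W"] by (auto simp: W_def w_def)
    also have "\<dots> = explored pick n I ?u (Suc t) - explored pick n I ?u t"
      using run[of t] run[of "Suc t"] that by simp
    also have "\<dots> = {visit pick n I ?u t}"
      using visit[OF that, of I ?u] by auto
    finally show ?thesis by simp
  qed
  have "(x, i) \<in> merged_graph pick n R I \<longleftrightarrow> (x, i) \<in> J" if x: "x < n" and i: "i < m" for x i
  proof -
    obtain t where t: "t < n" "x = w t" using visitE[OF x] unfolding w_def by metis
    then show ?thesis
      using merged_graph_visit_iff[OF t(1), of I R i] *[rule_format, OF t(1) i] run[of t] w[OF t(1)]
      by (simp split: if_splits)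
  qed
  then show "merged_graph pick n R I = J"
    using merged_graph_subset[OF R I] J by auto
qed

text \<open>The fibre over a graph \<open>J\<close> is a product event. Once times are renamed to
  visited vertices, its prescribed cells cover every cell exactly once, and the renaming preserves
  attributes, so the two probabilities multiply to that of \<open>J\<close>.\<close>

lemma map_pmf_merged_graph:
  fixes n m :: nat and p :: "nat \<Rightarrow> real"
  assumes p: "\<And>i. i < m \<Longrightarrow> 0 \<le> p i \<and> p i \<le> 1"
  defines "P \<equiv> random_bipartite n m p"
  shows "map_pmf (\<lambda>(R, I). merged_graph pick n R I) (pair_pmf P P) = P"
proof (rule pmf_eqI)
  fix J
  note sub = random_bipartite_subset[of _ n m p, folded P_def]
  show "pmf (map_pmf (\<lambda>(R, I). merged_graph pick n R I) (pair_pmf P P)) J = pmf P J"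
  proof (cases "J \<subseteq> {..<n} \<times> {..<m}")
    case False
    then have "J \<notin> set_pmf P" using sub by auto
    moreover have "J \<noteq> merged_graph pick n R I" if "R \<in> set_pmf P" "I \<in> set_pmf P" for R I
      using merged_graph_subset[OF sub[OF that(1)] sub[OF that(2)]] False by metis
    then have "J \<notin> set_pmf (map_pmf (\<lambda>(R, I). merged_graph pick n R I) (pair_pmf P P))"
      unfolding set_map_pmf set_pair_pmf by blast
    ultimately have "pmf P J = 0" "pmf (map_pmf (\<lambda>(R, I). merged_graph pick n R I) (pair_pmf P P)) J = 0"
      by (simp_all only: pmf_eq_0_set_pmf not_False_eq_True)
    then show ?thesis by simp
  next
    case J: True
    let ?A = "{..<n} \<times> {..<m}"
    define W where "W = explored pick n J (\<lambda>_ W. J `` W)"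
    define w where "w = visit pick n J (\<lambda>_ W. J `` W)"
    define Q where "Q t i \<longleftrightarrow> i \<in> J `` W t" for t i
    \<comment> \<open>\<open>S\<close> collects the cells \<open>(t, i)\<close> whose attribute
      \<open>i\<close> is already known before step \<open>t\<close> of exploring \<open>J\<close>:
      there \<open>I\<close> is read at \<open>\<phi> (t, i)\<close>, elsewhere \<open>R\<close> is
      read at \<open>(t, i)\<close>.\<close>
    define S where "S = {(t, i). t < n \<and> i < m \<and> Q t i}"
    define \<phi> where "\<phi> = (\<lambda>(t, i). (w t, i :: nat))"
    define g where "g = (\<lambda>e. if e \<in> J then p (snd e) else 1 - p (snd e))"
    have S: "S \<subseteq> ?A" by (auto simp: S_def)
    have \<phi>_apply: "\<phi> (t, i) = (w t, i)" for t i by (simp add: \<phi>_def)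
    have fresh_cells: "(\<forall>e\<in>?A - S. F e) \<longleftrightarrow> (\<forall>t<n. \<forall>i<m. \<not> Q t i \<longrightarrow> F (t, i))" for F
      by (auto simp: S_def)
    have incoming_cells: "(\<forall>e\<in>\<phi> ` S. F e) \<longleftrightarrow> (\<forall>t<n. \<forall>i<m. Q t i \<longrightarrow> F (w t, i))" for F
      by (auto simp: S_def \<phi>_def)
    have bij: "bij_betw \<phi> ?A ?A"
      unfolding bij_betw_def
    proof
      show "inj_on \<phi> ?A"
        using inj_on_visit[of n J "\<lambda>_ W. J `` W", folded w_def]
        by (auto simp: \<phi>_def intro!: inj_onI dest: inj_onD)
      have "\<phi> ` ?A = w ` {..<n} \<times> {..<m}" by (auto simp: \<phi>_def)
      then show "\<phi> ` ?A = ?A"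
        using visit_image[of n J "\<lambda>_ W. J `` W", folded w_def] by simp
    qed
    have inj: "inj_on \<phi> ?A" using bij by (auto simp: bij_betw_def)
    have \<phi>S: "\<phi> ` S \<subseteq> ?A" using bij S by (auto simp: bij_betw_def)
    have "pmf (map_pmf (\<lambda>(R, I). merged_graph pick n R I) (pair_pmf P P)) J =
        measure_pmf.prob (pair_pmf P P) {(R, I). merged_graph pick n R I = J}"
      by (simp add: pmf_map vimage_def case_prod_unfold)
    also have "\<dots> = measure_pmf.prob (pair_pmf P P)
       ({R. \<forall>e\<in>?A - S. e \<in> R \<longleftrightarrow> e \<in> {e. \<phi> e \<in> J}} \<times> {I. \<forall>e\<in>\<phi> ` S. e \<in> I \<longleftrightarrow> e \<in> J})"
    proof (rule measure_pmf.finite_measure_eq_AE)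
      show "AE x in measure_pmf (pair_pmf P P). (x \<in> {(R, I). merged_graph pick n R I = J}) =
       (x \<in> {R. \<forall>e\<in>?A - S. e \<in> R \<longleftrightarrow> e \<in> {e. \<phi> e \<in> J}} \<times> {I. \<forall>e\<in>\<phi> ` S. e \<in> I \<longleftrightarrow> e \<in> J})"
        unfolding AE_measure_pmf_iff
      proof (intro ballI)
        fix x assume x: "x \<in> set_pmf (pair_pmf P P)"
        obtain R I where "x = (R, I)" by force
        have RI: "R \<subseteq> ?A" "I \<subseteq> ?A" using x sub unfolding \<open>x = (R, I)\<close> by auto
        have "merged_graph pick n R I = J \<longleftrightarrow> (\<forall>t<n. \<forall>i<m.
            if Q t i then (w t, i) \<in> I \<longleftrightarrow> (w t, i) \<in> J else (t, i) \<in> R \<longleftrightarrow> (w t, i) \<in> J)"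
          unfolding Q_def W_def w_def by (rule merged_graph_eq_iff[OF RI J])
        also have "\<dots> \<longleftrightarrow> (\<forall>e\<in>?A - S. e \<in> R \<longleftrightarrow> \<phi> e \<in> J) \<and> (\<forall>e\<in>\<phi> ` S. e \<in> I \<longleftrightarrow> e \<in> J)"
          unfolding fresh_cells incoming_cells \<phi>_apply if_bool_eq_conj by blast
        finally show "(x \<in> {(R, I). merged_graph pick n R I = J}) =
          (x \<in> {R. \<forall>e\<in>?A - S. e \<in> R \<longleftrightarrow> e \<in> {e. \<phi> e \<in> J}} \<times> {I. \<forall>e\<in>\<phi> ` S. e \<in> I \<longleftrightarrow> e \<in> J})"
          unfolding \<open>x = (R, I)\<close> mem_Collect_eq prod.case mem_Sigma_iff .
      qed
    qed auto
    also have "\<dots> = measure_pmf.prob P {R. \<forall>e\<in>?A - S. e \<in> R \<longleftrightarrow> e \<in> {e. \<phi> e \<in> J}} *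
        measure_pmf.prob P {I. \<forall>e\<in>\<phi> ` S. e \<in> I \<longleftrightarrow> e \<in> J}"
      by (rule prob_pair_pmf_Times)
    also have "\<dots> = (\<Prod>e\<in>?A - S. g (\<phi> e)) * (\<Prod>e\<in>\<phi> ` S. g e)"
      unfolding P_def
      by (subst (1 2) prob_random_bipartite_agree)
        (use p S \<phi>S in \<open>auto simp: g_def \<phi>_def intro!: arg_cong2[where f = "(*)"] prod.cong\<close>)
    also have "(\<Prod>e\<in>\<phi> ` S. g e) = (\<Prod>e\<in>S. g (\<phi> e))"
      using inj_on_subset[OF inj S] by (simp add: prod.reindex)
    also have "(\<Prod>e\<in>?A - S. g (\<phi> e)) * (\<Prod>e\<in>S. g (\<phi> e)) = (\<Prod>e\<in>?A. g (\<phi> e))"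
      by (rule prod.subset_diff[symmetric]) (use S in auto)
    also have "\<dots> = (\<Prod>e\<in>?A. g e)"
      by (rule prod.reindex_bij_betw[OF bij])
    also have "\<dots> = measure_pmf.prob P {B. \<forall>e\<in>?A. e \<in> B \<longleftrightarrow> e \<in> J}"
      unfolding P_def g_def by (rule prob_random_bipartite_agree[symmetric]) (use p in auto)
    also have "\<dots> = measure_pmf.prob P {J}"
    proof (rule measure_pmf.finite_measure_eq_AE)
      show "AE B in measure_pmf P. (B \<in> {B. \<forall>e\<in>?A. e \<in> B \<longleftrightarrow> e \<in> J}) = (B \<in> {J})"
        unfolding AE_measure_pmf_iff using sub J by fastforce
    qed auto
    finally show ?thesis by (simp add: measure_pmf_single)
  qed
qed

end

section \<open>Components as excursions of the exploration\<close>

text \<open>Row \<open>x\<close> of \<open>I\<close> is tested for every \<open>x\<close>, explored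
  or not, which makes the memberships independent across vertices once \<open>R\<close> is
  given.\<close>

definition discovered :: "nat \<Rightarrow> (nat \<times> nat) set \<Rightarrow> (nat \<times> nat) set \<Rightarrow> nat \<Rightarrow> nat set" where
  "discovered n R I t = {x \<in> {..<n}. I `` {x} \<inter> R `` {..<t} \<noteq> {}}"

locale exploration = selection +
  fixes n m :: nat and R I :: "(nat \<times> nat) set"
  assumes R: "R \<subseteq> {..<n} \<times> {..<m}" and I: "I \<subseteq> {..<n} \<times> {..<m}"
begin

definition "W = explored pick n I (\<lambda>t _. R `` {..<t})"
definition "w = visit pick n I (\<lambda>t _. R `` {..<t})"
abbreviation "D \<equiv> discovered n R I"
definition "E = intersection_graph (merged_graph pick n R I)"
text \<open>At the closed times the explored vertices form a union of components.\<close>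

definition "closed_time t \<longleftrightarrow> D t \<subseteq> W t"
definition "excursion a b \<longleftrightarrow> a < b \<and> b \<le> n \<and> closed_time a \<and> closed_time b \<and>
  (\<forall>j. a < j \<and> j < b \<longrightarrow> \<not> closed_time j)"

lemma W_eq: "W t = w ` {..<t}"
  by (simp add: W_def w_def explored_conv_visit)

lemma w_bij: "bij_betw w {..<n} {..<n}"
  using inj_on_visit visit_image by (simp add: bij_betw_def w_def)

lemma inj_on_w: "X \<subseteq> {..<n} \<Longrightarrow> inj_on w X"
  using w_bij inj_on_subset by (auto simp: bij_betw_def)

lemma w_in_W_iff: "t \<le> n \<Longrightarrow> j < n \<Longrightarrow> w j \<in> W t \<longleftrightarrow> j < t"
  by (simp add: w_def W_def visit_in_explored_iff)

lemma W_subset: "t \<le> n \<Longrightarrow> W t \<subseteq> {..<n}"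
  and card_W: "t \<le> n \<Longrightarrow> card (W t) = t"
  using explored_props by (auto simp: W_def)

lemma w_less: "t < n \<Longrightarrow> w t < n"
  using w_bij by (auto simp: bij_betw_def)

lemma finite_D: "finite (D t)" by (simp add: discovered_def)

lemma D_mono: "s \<le> t \<Longrightarrow> D s \<subseteq> D t"
  by (fastforce simp: discovered_def)

lemma merged_graph_attributes: "t \<le> n \<Longrightarrow> merged_graph pick n R I `` W t = R `` {..<t}"
  using explored_merged_graph[of t n R I] by (simp add: W_def)

lemma merged_graph_unexplored:
  assumes "t \<le> n" "x < n" "x \<notin> W t"
  shows "merged_graph pick n R I `` {x} \<inter> R `` {..<t} = I `` {x} \<inter> R `` {..<t}"
proof -
  obtain s where s: "s < n" "x = w s" using visitE[OF assms(2)] unfolding w_def by metis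
  have "s \<ge> t" using assms s w_in_W_iff[of t s] by auto
  then have "R `` {..<t} \<subseteq> R `` {..<s}" by auto
  then have "i \<in> merged_graph pick n R I `` {x} \<inter> R `` {..<t} \<longleftrightarrow> i \<in> I `` {x} \<inter> R `` {..<t}" for i
    using merged_graph_visit_iff[OF s(1), of I R i] unfolding s(2) w_def
    by (cases "i \<in> R `` {..<t}") (simp_all add: subsetD)
  then show ?thesis by blast
qed

lemma E_subset: "E \<subseteq> {..<n} \<times> {..<n}"
  using merged_graph_subset[OF R I] by (auto simp: E_def intersection_graph_def)

lemma sym_E: "sym E"
  by (auto simp: E_def intersection_graph_def sym_def)

lemma closed_time_no_edge:
  assumes "closed_time t" "t \<le> n" "x \<in> W t" "y \<notin> W t"
  shows "(x, y) \<notin> E"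
proof
  assume e: "(x, y) \<in> E"
  then obtain a where a: "(x, a) \<in> merged_graph pick n R I" "(y, a) \<in> merged_graph pick n R I"
    by (auto simp: E_def intersection_graph_def)
  have y: "y < n" using e E_subset by auto
  have "a \<in> R `` {..<t}" using a(1) assms(3) merged_graph_attributes[OF assms(2)] by blast
  then have "a \<in> I `` {y} \<inter> R `` {..<t}"
    using merged_graph_unexplored[OF assms(2) y assms(4)] a(2) by auto
  then have "y \<in> D t" using y by (auto simp: discovered_def)
  then show False using assms by (auto simp: closed_time_def)
qed

text \<open>At an open time the candidate set of \<open>next_vertex\<close> is nonempty, so the next
  vertex is taken from it and shares an attribute with an earlier one.\<close>

lemma not_closed_time:
  assumes "\<not> closed_time t" "t < n"
  shows "w t \<in> D t" "\<exists>j<t. (w j, w t) \<in> E"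
proof -
  define A where "A = {x \<in> {..<n} - W t. I `` {x} \<inter> R `` {..<t} \<noteq> {}}"
  have "A \<noteq> {}" using assms by (auto simp: A_def closed_time_def discovered_def)
  have "w t = pick (if A = {} then {..<n} - W t else A)"
    unfolding w_def visit_def next_vertex_def A_def W_def Let_def by (rule refl)
  also have "\<dots> = pick A" using \<open>A \<noteq> {}\<close> by simp
  finally have "w t = pick A" .
  with pick \<open>A \<noteq> {}\<close> have w: "w t \<in> A" by metis
  then show "w t \<in> D t" by (auto simp: A_def discovered_def)
  have t: "t \<le> n" "w t < n" "w t \<notin> W t" using w assms by (auto simp: A_def)
  obtain a where "a \<in> merged_graph pick n R I `` {w t}" "a \<in> merged_graph pick n R I `` W t"
    using merged_graph_unexplored[OF t] merged_graph_attributes[OF t(1)] w by (auto simp: A_def)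
  then obtain j where "j < t" "(w j, a) \<in> merged_graph pick n R I" "(w t, a) \<in> merged_graph pick n R I"
    by (auto simp: W_eq)
  moreover from this have "w j \<noteq> w t" using t(3) unfolding W_eq by (metis imageI lessThan_iff)
  ultimately show "\<exists>j<t. (w j, w t) \<in> E"
    by (auto simp: E_def intersection_graph_def)
qed

lemma closed_time_0: "closed_time 0" and closed_time_n: "closed_time n"
  using visit_image by (auto simp: closed_time_def discovered_def W_eq w_def)

text \<open>No edge crosses a closed time, which confines the component; conversely every vertex
  after \<open>w a\<close> has an earlier neighbour, not before \<open>a\<close>, so strong
  induction links it to \<open>w a\<close>.\<close>

lemma excursion_component:
  assumes ex: "excursion a b"
  shows "E\<^sup>* `` {w a} = w ` {a..<b}"
proof
  have ab: "a < b" "b \<le> n" "closed_time a" "closed_time b"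
    and nc: "\<And>j. a < j \<Longrightarrow> j < b \<Longrightarrow> \<not> closed_time j" using ex by (auto simp: excursion_def)
  have S: "w ` {a..<b} = W b - W a"
  proof -
    have "{a..<b} = {..<b} - {..<a}" "{a..<b} \<subseteq> {..<n}" using ab by auto
    then show ?thesis
      using inj_on_image_set_diff[OF inj_on_w[OF order_refl], of "{..<b}" "{..<a}"] ab
      by (simp add: W_eq Diff_subset)
  qed
  have "y \<in> W b - W a" if "(w a, y) \<in> E\<^sup>*" for y
    using that
  proof (induction rule: rtrancl_induct)
    case base
    then show ?case using ab w_in_W_iff[of a a] by (auto simp: W_eq)
  next
    case (step y z)
    have "(z, y) \<in> E" using step sym_E by (auto simp: sym_def)
    then show ?case
      using closed_time_no_edge[OF ab(3), of z y] closed_time_no_edge[OF ab(4), of y z] step ab by auto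
  qed
  then show "E\<^sup>* `` {w a} \<subseteq> w ` {a..<b}" using S by auto
  have "(w a, w j) \<in> E\<^sup>*" if "a \<le> j" "j < b" for j
    using that
  proof (induction j rule: less_induct)
    case (less j)
    show ?case
    proof (cases "j = a")
      case False
      then obtain i where i: "i < j" "(w i, w j) \<in> E"
        using not_closed_time[OF nc, of j] less.prems ab by auto
      have "i \<ge> a"
        using closed_time_no_edge[OF ab(3), of "w i" "w j"] i less.prems ab
          w_in_W_iff[of a j] w_in_W_iff[of a i] by force
      then show ?thesis using less.IH[of i] i less.prems by (auto intro: rtrancl_into_rtrancl)
    qed simp
  qed
  then show "w ` {a..<b} \<subseteq> E\<^sup>* `` {w a}" by auto
qed

lemma excursion_covers:
  assumes "j < n"
  obtains a b where "excursion a b" "a \<le> j" "j < b"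
proof -
  define a where "a = (GREATEST a. closed_time a \<and> a \<le> j)"
  define b where "b = (LEAST b. closed_time b \<and> j < b)"
  have a: "closed_time a \<and> a \<le> j"
    unfolding a_def by (rule GreatestI_nat[where b = j and k = 0]) (auto simp: closed_time_0)
  have a': "s \<le> a" if "closed_time s" "s \<le> j" for s
    unfolding a_def by (rule Greatest_le_nat[where b = j]) (use that in auto)
  have b: "closed_time b \<and> j < b"
    unfolding b_def by (rule LeastI[where k = n]) (use closed_time_n assms in auto)
  have b': "b \<le> s" if "closed_time s" "j < s" for s
    unfolding b_def by (rule Least_le) (use that in auto)
  have "excursion a b"
    using a a' b b' closed_time_n assms unfolding excursion_def
    by (metis leD le_less_linear order_less_le_trans)
  then show ?thesis using that a b by blast
qed

lemma components_iff_excursion: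
  "C \<in> graph_components {..<n} E \<longleftrightarrow> (\<exists>a b. excursion a b \<and> C = w ` {a..<b})"
proof
  assume "C \<in> graph_components {..<n} E"
  then obtain x where x: "x < n" "C = E\<^sup>* `` {x}"
    by (auto simp: graph_components_def quotient_def)
  obtain j where j: "j < n" "x = w j" using visitE[OF x(1)] unfolding w_def by metis
  obtain a b where ex: "excursion a b" "a \<le> j" "j < b" using excursion_covers[OF j(1)] .
  then have "x \<in> E\<^sup>* `` {w a}" using j excursion_component by auto
  moreover have "sym (E\<^sup>*)" by (rule sym_rtrancl[OF sym_E])
  ultimately have "E\<^sup>* `` {x} = E\<^sup>* `` {w a}"
    by (auto simp: sym_def intro: rtrancl_trans)
  then show "\<exists>a b. excursion a b \<and> C = w ` {a..<b}"
    using ex excursion_component x by auto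
next
  assume "\<exists>a b. excursion a b \<and> C = w ` {a..<b}"
  then obtain a b where ex: "excursion a b" and C: "C = w ` {a..<b}" by auto
  have "C = E\<^sup>* `` {w a}" using excursion_component[OF ex] C by simp
  moreover have "w a < n" using ex w_less[of a] by (auto simp: excursion_def)
  ultimately show "C \<in> graph_components {..<n} E"
    by (auto simp: graph_components_def quotient_def)
qed

lemma card_excursion: "excursion a b \<Longrightarrow> card (w ` {a..<b}) = b - a"
  by (subst card_image) (auto intro!: inj_on_w simp: excursion_def)

section \<open>Component sizes and the growth of the discovered set\<close>

lemma card_D_closed_time: "closed_time t \<Longrightarrow> t \<le> n \<Longrightarrow> card (D t) \<le> t"
  using card_mono[of "W t" "D t"] W_subset[of t] card_W[of t] finite_subset
  by (auto simp: closed_time_def)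

text \<open>All vertices of an excursion except its first are discovered within it, and none of them
  lies in \<open>D a\<close>, since \<open>D a\<close> is contained in \<open>W a\<close>. The
  summand 1 accounts for the first vertex, which need not be discovered.\<close>

lemma card_D_excursion:
  assumes ex: "excursion a b" and t: "a < t" "t \<le> b"
  shows "card (D a) + t \<le> card (D t) + a + 1"
proof -
  have ab: "a < b" "b \<le> n" "closed_time a" using ex by (auto simp: excursion_def)
  have disj: "D a \<inter> w ` {a<..<t} = {}"
    using ab t w_in_W_iff[of a] by (auto simp: closed_time_def)
  have "w j \<in> D t" if "a < j" "j < t" for j
  proof -
    have "w j \<in> D j" using not_closed_time(1)[of j] ex that t by (auto simp: excursion_def)
    then show ?thesis using D_mono[of j t] that by auto
  qed
  then have sub: "D a \<union> w ` {a<..<t} \<subseteq> D t" using D_mono[of a t] t by auto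
  have "inj_on w {a<..<t}"
    using ab t by (intro inj_on_w) auto
  then have "card (D a) + (t - Suc a) = card (D a \<union> w ` {a<..<t})"
    using disj finite_D by (simp add: card_Un_disjoint card_image)
  also have "\<dots> \<le> card (D t)" by (rule card_mono[OF finite_D sub])
  finally show ?thesis using t by simp
qed

text \<open>The component of \<open>w 0\<close> is the excursion from time 0, so its size is a
  closed time \<open>b\<close>, and \<open>card (D b) \<le> b\<close> keeps \<open>b\<close> out of
  \<open>{l..k}\<close>.\<close>

lemma first_component_dichotomy:
  assumes above: "\<And>t. l \<le> t \<Longrightarrow> t \<le> k \<Longrightarrow> t < card (D t)" and k: "k \<le> n"
    and C: "C \<in> graph_components {..<n} E" "w 0 \<in> C"
  shows "card C < l \<or> k < card C"
proof -
  obtain a b where ex: "excursion a b" and Ceq: "C = w ` {a..<b}"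
    using C(1) components_iff_excursion by auto
  then obtain j where "a \<le> j" "j < b" "w 0 = w j" using C(2) by auto
  then have "a = 0"
    using ex inj_onD[OF inj_on_w[of "{..<n}"], of 0 j] by (auto simp: excursion_def)
  then have "card C = b" "closed_time b" "b \<le> n"
    using ex Ceq card_excursion by (auto simp: excursion_def)
  then show ?thesis using above[of b] card_D_closed_time[of b] by force
qed

text \<open>The giant is the excursion in progress at time \<open>k\<close>: it began before
  \<open>l\<close>, and going past \<open>u\<close> would violate \<open>ends\<close>. Earlier
  excursions fit below \<open>l\<close>; a later one longer than \<open>k\<close> would need nearly
  unit growth of \<open>D\<close>, which \<open>after\<close> excludes.\<close>

lemma giant_component:
  assumes above: "\<And>t. l \<le> t \<Longrightarrow> t \<le> k \<Longrightarrow> t < card (D t)" and k: "k \<le> n" "l \<le> k"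
    and ends: "u < n \<Longrightarrow> card (D (u + 1)) + l \<le> u"
    and after: "\<And>a b. k < a \<Longrightarrow> a + k < b \<Longrightarrow> b \<le> n \<Longrightarrow> card (D b) + a + 1 < card (D a) + b"
  obtains C where "C \<in> graph_components {..<n} E" "k < card C + l" "card C \<le> u"
    "\<forall>C'\<in>graph_components {..<n} E. C' \<noteq> C \<longrightarrow> card C' \<le> k"
proof -
  have "k \<noteq> n" using above[of n] k card_D_closed_time[OF closed_time_n] by auto
  then have "k < n" using k by simp
  then obtain a b where ex: "excursion a b" and ab: "a \<le> k" "k < b"
    using excursion_covers by metis
  have "closed_time a" "a \<le> n" using ex by (auto simp: excursion_def)
  then have a: "a < l" using above[of a] card_D_closed_time[of a] ab by force
  have b: "b \<le> u"
  proof (rule ccontr)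
    assume "\<not> b \<le> u"
    moreover have "u < n" using calculation ex by (auto simp: excursion_def)
    moreover have "a < u + 1" using ends[OF \<open>u < n\<close>] a by simp
    ultimately show False
      using card_D_excursion[OF ex, of "u + 1"] ends a by auto
  qed
  show ?thesis
  proof (rule that[of "w ` {a..<b}"])
    show "w ` {a..<b} \<in> graph_components {..<n} E" using ex components_iff_excursion by auto
    show "k < card (w ` {a..<b}) + l" "card (w ` {a..<b}) \<le> u"
      using card_excursion[OF ex] ab a b by auto
    have "card C' \<le> k" if "C' \<in> graph_components {..<n} E" and ne: "C' \<noteq> w ` {a..<b}" for C'
    proof -
      from that obtain a' b' where ex': "excursion a' b'" and C': "C' = w ` {a'..<b'}"
        using components_iff_excursion by auto
      have "b' \<le> a \<or> b \<le> a'"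
        using ex ex' ne unfolding C' excursion_def by (metis leI linorder_neqE_nat)
      then have "b' - a' \<le> k"
      proof
        assume "b' \<le> a" then show ?thesis using a k by simp
      next
        assume le: "b \<le> a'"
        show ?thesis
        proof (rule ccontr)
          assume "\<not> ?thesis"
          then have "card (D b') + a' + 1 < card (D a') + b'"
            using after[of a' b'] le ab ex' by (auto simp: excursion_def)
          then show False
            using card_D_excursion[OF ex', of b'] ex' by (auto simp: excursion_def)
        qed
      qed
      then show "card C' \<le> k" using card_excursion[OF ex'] C' by simp
    qed
    then show "\<forall>C'\<in>graph_components {..<n} E. C' \<noteq> w ` {a..<b} \<longrightarrow> card C' \<le> k" by blast
  qed
qed

end

section \<open>Concentration of the number of discovered vertices\<close>

lemma one_minus_exp_ge:
  fixes x :: real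
  assumes "0 \<le> x"
  shows "x - x\<^sup>2 / 2 \<le> 1 - exp (- x)"
proof -
  have e: "1 + x + x\<^sup>2 / 2 \<le> exp x" by (rule exp_lower_Taylor_quadratic[OF assms])
  \<comment> \<open>The conjugate factor makes the product at least 1, so dividing by
    \<open>exp x\<close> turns the lower bound for \<open>exp x\<close> into an upper bound for
    \<open>exp (- x)\<close>.\<close>
  have "(1 + x + x\<^sup>2 / 2) * (1 - x + x\<^sup>2 / 2) = 1 + (x\<^sup>2)\<^sup>2 / 4"
    by (simp add: field_simps power2_eq_square)
  then have "1 \<le> (1 + x + x\<^sup>2 / 2) * (1 - x + x\<^sup>2 / 2)" by simp
  also have "\<dots> \<le> exp x * (1 - x + x\<^sup>2 / 2)"
  proof (rule mult_right_mono[OF e])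
    have "0 \<le> ((1 - x)\<^sup>2 + 1) / 2" by simp
    also have "\<dots> = 1 - x + x\<^sup>2 / 2" by (simp add: field_simps power2_eq_square)
    finally show "0 \<le> 1 - x + x\<^sup>2 / 2" .
  qed
  finally show ?thesis by (simp add: exp_minus field_simps)
qed

lemma one_minus_exp_ge_linear:
  fixes x :: real
  assumes "0 \<le> x" "x \<le> b"
  shows "x * (1 - b / 2) \<le> 1 - exp (- x)"
proof -
  have "x * (1 - b / 2) \<le> x * (1 - x / 2)" using assms by (intro mult_left_mono) auto
  also have "\<dots> = x - x\<^sup>2 / 2" by (simp add: algebra_simps power2_eq_square)
  also have "\<dots> \<le> 1 - exp (- x)" by (rule one_minus_exp_ge[OF assms(1)])
  finally show ?thesis .
qed

lemma abs_exp_minus_diff_le: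
  fixes a b :: real
  assumes "0 \<le> a" "0 \<le> b"
  shows "\<bar>exp (- a) - exp (- b)\<bar> \<le> \<bar>a - b\<bar>"
proof -
  have *: "\<bar>exp (- a) - exp (- b)\<bar> \<le> \<bar>a - b\<bar>" if "0 \<le> a" "a \<le> b" for a b :: real
  proof -
    have "exp (- a) - exp (- b) = exp (- a) * (1 - exp (- (b - a)))"
      by (simp add: algebra_simps flip: exp_add)
    also have "\<dots> \<le> 1 * (b - a)"
    proof (rule mult_mono)
      show "1 - exp (- (b - a)) \<le> b - a"
        using exp_ge_add_one_self[of "- (b - a)"] by linarith
    qed (use that in auto)
    finally show ?thesis using that by simp
  qed
  show ?thesis using *[of a b] *[of b a] assms by linarith
qed

lemma power_one_minus_le_exp:
  fixes x :: real
  assumes "x \<le> 1"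
  shows "(1 - x) ^ k \<le> exp (- (real k * x))"
proof -
  have "(1 - x) ^ k \<le> exp (- x) ^ k"
    using exp_ge_add_one_self[of "- x"] assms by (intro power_mono) auto
  then show ?thesis by (simp add: exp_of_nat_mult[symmetric])
qed

lemma exp_le_power_one_minus:
  fixes x :: real
  assumes "0 \<le> x" "x \<le> 1 / 2"
  shows "exp (- (real k * (x + 2 * x\<^sup>2))) \<le> (1 - x) ^ k"
proof -
  have "exp (- x - 2 * x\<^sup>2) \<le> exp (ln (1 - x))"
    using ln_one_minus_pos_lower_bound[OF assms] by simp
  then have "exp (- x - 2 * x\<^sup>2) ^ k \<le> (1 - x) ^ k"
    using assms by (intro power_mono) auto
  then show ?thesis by (simp add: exp_of_nat_mult[symmetric] algebra_simps)
qed

text \<open>\<open>M\<close> stands for \<open>max 1 (n * max_prob m p)\<close>, the factor by which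
  large attributes shorten the initial time scale and weaken the tail exponent.\<close>

locale rig_params =
  fixes n m :: nat and p :: "nat \<Rightarrow> real" and c M :: real
  assumes prob: "i < m \<Longrightarrow> 0 \<le> p i \<and> p i \<le> 1"
    and n: "n \<ge> 1" and c: "c > 1"
    and sum_sq: "real n * (\<Sum>i<m. (p i)\<^sup>2) = c"
    and M: "M \<ge> 1" and p_le_M: "i < m \<Longrightarrow> real n * p i \<le> M"
begin

text \<open>
  The factor \<open>\<eta>\<close> is so small that up to time \<open>\<eta> * n / M\<close> all second order errors together use up
  at most half of the surplus \<open>c - 1\<close>.
\<close>

definition "\<eta> = (c - 1) / (2 * c * (c + 1))"
definition "B = random_bipartite n m p"
abbreviation "f \<equiv> extinction_fun n m p"

lemma eta: "\<eta> > 0" "c * \<eta> * (c + 1) = (c - 1) / 2" "c * \<eta> \<le> (c - 1) / 4" "c * (c * \<eta>) \<le> (c - 1) / 2"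
  "\<eta> \<le> c * \<eta>" "\<eta> \<le> 1"
proof -
  show e: "\<eta> > 0" and e2: "c * \<eta> * (c + 1) = (c - 1) / 2"
    using c by (auto simp: \<eta>_def divide_simps)
  have "c * \<eta> * 2 \<le> c * \<eta> * (c + 1)" using c e by (intro mult_left_mono) auto
  then show "c * \<eta> \<le> (c - 1) / 4" using e2 by simp
  have "c * \<eta> * c \<le> c * \<eta> * (c + 1)" using c e by (intro mult_left_mono) auto
  then have "c * \<eta> * c \<le> (c - 1) / 2" using e2 by linarith
  then show "c * (c * \<eta>) \<le> (c - 1) / 2" by (simp add: ac_simps)
  show "\<eta> \<le> c * \<eta>" using c e by simp
  have "2 * c * (c + 1) \<ge> 2 * c * 1" using c by (intro mult_left_mono) auto
  then have "c - 1 \<le> 2 * c * (c + 1)" using c by linarith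
  then show "\<eta> \<le> 1" using c by (simp add: \<eta>_def)
qed

lemma eta_factors: "1 - c * \<eta> \<le> (1 - c * \<eta> / 2) * (1 - \<eta> / 2)"
proof -
  have "(1 - c * \<eta> / 2) * (1 - \<eta> / 2) = 1 - c * \<eta> / 2 - \<eta> / 2 + c * \<eta> * \<eta> / 4"
    by (simp add: field_simps)
  moreover have "0 \<le> c * \<eta> * \<eta>" using c eta by simp
  ultimately show ?thesis using eta(5) by linarith
qed

lemma sum_sq': "(\<Sum>i<m. (p i)\<^sup>2) = c / n"
  using sum_sq n by (simp add: field_simps)

section \<open>Lower tails of the discovered set at early times\<close>

lemma hit_attribute_iff: "R \<inter> {..<t} \<times> {i} = {} \<longleftrightarrow> i \<notin> R `` {..<t}"
  by auto

lemma prod_column: "(\<Prod>e\<in>{..<t} \<times> {i}. 1 - p (snd e)) = (1 - p i) ^ t"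
proof -
  have "(\<Prod>e\<in>{..<t} \<times> {i}. 1 - p (snd e)) = (\<Prod>e\<in>{..<t} \<times> {i}. 1 - p i)"
    by (rule prod.cong) auto
  then show ?thesis by (simp add: card_cartesian_product)
qed

lemma prod_row: "(\<Prod>e\<in>{x} \<times> U. 1 - p (snd e)) = (\<Prod>i\<in>U. 1 - p i)"
proof -
  have "{x} \<times> U = Pair x ` U" by auto
  then show ?thesis by (simp add: prod.reindex inj_on_def)
qed

text \<open>The mean weight is close to \<open>c * t / n\<close>: attribute \<open>i\<close> is
  found with probability about \<open>t * p i\<close> and weighs \<open>p i\<close>. The threshold
  gives up half of the surplus \<open>c - 1\<close>, which leaves room for the Chernoff
  bound.\<close>

lemma attribute_weight_lower_tail:
  assumes t: "real t \<le> \<eta> * n / M"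
  shows "measure_pmf.prob B {R. (\<Sum>i<m. if i \<in> R `` {..<t} then p i else 0) \<le> (c + 1) / 2 * t / n}
     \<le> exp (- (\<eta> * (c - 1) / 4 * t / M))"
proof -
  \<comment> \<open>This scale keeps every \<open>y * p i\<close> at most \<open>\<eta>\<close>, so
    that \<open>1 - exp (- (y * p i))\<close> is nearly linear, while the exponent is still of order
    \<open>t / M\<close>.\<close>
  define y where "y = \<eta> * n / M"
  have y: "y > 0" using eta n M by (simp add: y_def)
  have "\<eta> * n / M \<le> n" using eta M n mult_mono[of \<eta> 1 "real n" "real n * M"]
    by (simp add: field_simps)
  with t have tn: "t \<le> n" by simp
  have eq: "{R. (\<Sum>i<m. if i \<in> R `` {..<t} then p i else 0) \<le> (c + 1) / 2 * t / n}
     = {R. hit_sum {..<m} (\<lambda>i. {..<t} \<times> {i}) (\<lambda>i. y * p i) R \<le> y * ((c + 1) / 2 * t / n)}"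
  proof -
    have "hit_sum {..<m} (\<lambda>i. {..<t} \<times> {i}) (\<lambda>i. y * p i) R
       = y * (\<Sum>i<m. if i \<in> R `` {..<t} then p i else 0)" for R
      by (simp add: hit_sum_def hit_attribute_iff sum_distrib_left if_distrib cong: if_cong)
         (auto intro!: sum.cong)
    then show ?thesis by (simp only: mult_le_cancel_left_pos[OF y])
  qed
  have "measure_pmf.prob B {R. hit_sum {..<m} (\<lambda>i. {..<t} \<times> {i}) (\<lambda>i. y * p i) R \<le> y * ((c + 1) / 2 * t / n)}
    \<le> exp (y * ((c + 1) / 2 * t / n) - (\<Sum>i<m. (1 - (1 - p i) ^ t) * (1 - exp (- (y * p i)))))"
    unfolding B_def
    by (rule hit_sum_lower_tail[where p = p and S = "\<lambda>i. {..<t} \<times> {i}", unfolded prod_column])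
      (use prob tn in \<open>auto simp: disjoint_family_on_def\<close>)
  also have "\<dots> \<le> exp (- (\<eta> * (c - 1) / 4 * t / M))"
  proof -
    have "(p i)\<^sup>2 * (t * y * (1 - \<eta>)) \<le> (1 - (1 - p i) ^ t) * (1 - exp (- (y * p i)))" if i: "i < m" for i
    proof -
      have pt: "real t * p i \<le> \<eta>"
      proof -
        have "real t * p i \<le> \<eta> * n / M * p i" using t prob[OF i] by (intro mult_right_mono) auto
        also have "\<dots> = \<eta> * (n * p i) / M" by simp
        also have "\<dots> \<le> \<eta> * M / M" using p_le_M[OF i] eta M by (intro divide_right_mono mult_left_mono) auto
        finally show ?thesis using M by simp
      qed
      have yp: "y * p i \<le> \<eta>"
      proof -
        have "y * p i = \<eta> * (n * p i) / M" by (simp add: y_def)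
        also have "\<dots> \<le> \<eta> * M / M" using p_le_M[OF i] eta M by (intro divide_right_mono mult_left_mono) auto
        finally show ?thesis using M by simp
      qed
      have a: "real t * p i * (1 - \<eta> / 2) \<le> 1 - (1 - p i) ^ t"
        using one_minus_exp_ge_linear[of "real t * p i" \<eta>] power_one_minus_le_exp[of "p i" t] pt prob[OF i]
        by simp
      have b: "y * p i * (1 - \<eta> / 2) \<le> 1 - exp (- (y * p i))"
        using one_minus_exp_ge_linear[of "y * p i" \<eta>] yp y prob[OF i] by simp
      have "(p i)\<^sup>2 * (t * y * (1 - \<eta>)) \<le> (p i)\<^sup>2 * (t * y * ((1 - \<eta> / 2) * (1 - \<eta> / 2)))"
        using y by (intro mult_left_mono) (auto simp: algebra_simps)
      also have "\<dots> = (real t * p i * (1 - \<eta> / 2)) * (y * p i * (1 - \<eta> / 2))"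
        by (simp add: power2_eq_square)
      also have "\<dots> \<le> (1 - (1 - p i) ^ t) * (1 - exp (- (y * p i)))"
      proof (rule mult_mono[OF a b])
        show "0 \<le> 1 - (1 - p i) ^ t" using prob[OF i] by (simp add: power_le_one)
        show "0 \<le> y * p i * (1 - \<eta> / 2)" using y prob[OF i] eta by simp
      qed
      finally show ?thesis .
    qed
    then have "(\<Sum>i<m. (p i)\<^sup>2 * (t * y * (1 - \<eta>))) \<le> (\<Sum>i<m. (1 - (1 - p i) ^ t) * (1 - exp (- (y * p i))))"
      by (intro sum_mono) auto
    then have "y * ((c + 1) / 2 * t / n) - (\<Sum>i<m. (1 - (1 - p i) ^ t) * (1 - exp (- (y * p i))))
       \<le> y * ((c + 1) / 2 * t / n) - c / n * (t * y * (1 - \<eta>))"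
      by (simp add: sum_distrib_right[symmetric] sum_sq')
    also have "\<dots> = (y * t / n) * (c * \<eta> - (c - 1) / 2)"
      using n by (simp add: divide_simps) (simp add: algebra_simps)
    also have "\<dots> \<le> (y * t / n) * (- ((c - 1) / 4))"
    proof (rule mult_left_mono)
      show "c * \<eta> - (c - 1) / 2 \<le> - ((c - 1) / 4)" using eta(3) by argo
    qed (use y in auto)
    also have "\<dots> = - (\<eta> * (c - 1) / 4 * t / M)"
      using n by (simp add: y_def mult.commute mult.left_commute)
    finally show ?thesis by simp
  qed
  finally show ?thesis using eq by simp
qed

text \<open>Given \<open>U\<close>, vertices are hit independently with probability at least about
  \<open>(c + 1) / 2 * t / n\<close>, so the mean exceeds \<open>t\<close> by a constant factor.
  With Chernoff parameter \<open>\<eta>\<close>, the second-order losses cost half of the exponent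
  \<open>\<eta> * (c - 1) / 2 * t\<close>.\<close>

lemma discovered_lower_tail_given:
  assumes U: "U \<subseteq> {..<m}" and t: "real t \<le> \<eta> * n / M" and w: "(c + 1) / 2 * t / n \<le> (\<Sum>i\<in>U. p i)"
  shows "measure_pmf.prob B {I. card {x \<in> {..<n}. I `` {x} \<inter> U \<noteq> {}} \<le> t} \<le> exp (- (\<eta> * (c - 1) / 4 * t))"
proof -
  have finU: "finite U" using U finite_subset by auto
  define \<tau> where "\<tau> = (c + 1) / 2 * t / n"
  have "\<eta> * n / M \<le> \<eta> * n / 1" using M eta by (intro divide_left_mono) auto
  with t have tn: "real t / n \<le> \<eta>" using n by (simp add: field_simps)
  have "\<tau> = (c + 1) / 2 * (t / n)" by (simp add: \<tau>_def)
  also have "\<dots> \<le> c * \<eta>" using tn c eta by (intro mult_mono) auto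
  finally have tau: "0 \<le> \<tau>" "\<tau> \<le> c * \<eta>" using c by (auto simp: \<tau>_def)
  define q where "q = 1 - (\<Prod>i\<in>U. 1 - p i)"
  have "(\<Prod>i\<in>U. 1 - p i) \<le> (\<Prod>i\<in>U. exp (- p i))"
  proof (rule prod_mono)
    fix i assume "i \<in> U"
    then show "0 \<le> 1 - p i \<and> 1 - p i \<le> exp (- p i)"
      using U prob[of i] exp_ge_add_one_self[of "- p i"] by auto
  qed
  also have "\<dots> = exp (- (\<Sum>i\<in>U. p i))" using finU by (simp add: exp_sum sum_negf[symmetric])
  also have "\<dots> \<le> exp (- \<tau>)" using w by (simp add: \<tau>_def)
  finally have "1 - exp (- \<tau>) \<le> q" by (simp add: q_def)
  moreover have "exp (- \<tau>) \<le> 1" using tau by simp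
  ultimately have q0: "0 \<le> q" and q: "\<tau> * (1 - c * \<eta> / 2) \<le> q"
    using one_minus_exp_ge_linear[OF tau] by linarith+
  have "hit_sum {..<n} (\<lambda>x. {x} \<times> U) (\<lambda>_. \<eta>) I = \<eta> * card {x \<in> {..<n}. I `` {x} \<inter> U \<noteq> {}}" for I
  proof -
    have "I \<inter> {x} \<times> U = {} \<longleftrightarrow> I `` {x} \<inter> U = {}" for x by auto
    then show ?thesis by (simp add: hit_sum_def sum.If_cases Int_def conj_commute)
  qed
  then have "measure_pmf.prob B {I. card {x \<in> {..<n}. I `` {x} \<inter> U \<noteq> {}} \<le> t}
     = measure_pmf.prob B {I. hit_sum {..<n} (\<lambda>x. {x} \<times> U) (\<lambda>_. \<eta>) I \<le> \<eta> * t}"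
    using eta by simp
  also have "\<dots> \<le> exp (\<eta> * t - (\<Sum>x<n. q * (1 - exp (- \<eta>))))"
    unfolding B_def q_def
    by (rule hit_sum_lower_tail[where p = p and S = "\<lambda>x. {x} \<times> U", unfolded prod_row])
      (use prob U in \<open>auto simp: disjoint_family_on_def\<close>)
  also have "\<dots> \<le> exp (- (\<eta> * (c - 1) / 4 * t))"
  proof -
    have "\<eta> * ((c + 1) / 2 * t) * (1 - c * \<eta>) \<le> \<eta> * ((c + 1) / 2 * t) * ((1 - c * \<eta> / 2) * (1 - \<eta> / 2))"
      using eta c eta_factors by (intro mult_left_mono) auto
    also have "\<dots> = n * ((\<tau> * (1 - c * \<eta> / 2)) * (\<eta> * (1 - \<eta> / 2)))"
      using n by (simp add: \<tau>_def)
    also have "\<dots> \<le> n * (q * (1 - exp (- \<eta>)))"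
      using one_minus_exp_ge_linear[of \<eta> \<eta>] eta q q0 tau c
      by (intro mult_left_mono mult_mono) auto
    finally have "\<eta> * t - n * (q * (1 - exp (- \<eta>))) \<le> \<eta> * t - \<eta> * ((c + 1) / 2 * t) * (1 - c * \<eta>)"
      by simp
    also have "\<dots> = \<eta> * t * (c * \<eta> * (c + 1) / 2 - (c - 1) / 2)"
      by (simp add: field_simps)
    also have "\<dots> = - (\<eta> * (c - 1) / 4 * t)" unfolding eta(2) by (simp add: field_simps)
    finally show ?thesis by simp
  qed
  finally show ?thesis .
qed

lemma discovered_lower_tail:
  assumes t: "real t \<le> \<eta> * n / M"
  shows "measure_pmf.prob (pair_pmf B B) {(R, I). card (discovered n R I t) \<le> t}
     \<le> 2 * exp (- (\<eta> * (c - 1) / 4 * t / M))"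
proof -
  have "measure_pmf.prob (pair_pmf B B) {(R, I). card (discovered n R I t) \<le> t}
     \<le> exp (- (\<eta> * (c - 1) / 4 * t / M)) + exp (- (\<eta> * (c - 1) / 4 * t))"
  proof (rule prob_pair_pmf_le[OF attribute_weight_lower_tail[OF t]])
    fix R assume R: "R \<in> set_pmf B"
      and w: "R \<notin> {R. (\<Sum>i<m. if i \<in> R `` {..<t} then p i else 0) \<le> (c + 1) / 2 * t / n}"
    have sub: "R `` {..<t} \<subseteq> {..<m}" using random_bipartite_subset[of R n m p] R by (auto simp: B_def)
    then have "(\<Sum>i<m. if i \<in> R `` {..<t} then p i else 0) = (\<Sum>i\<in>R `` {..<t}. p i)"
      by (simp add: sum.If_cases Int_absorb1)
    then show "measure_pmf.prob B {I. (R, I) \<in> {(R, I). card (discovered n R I t) \<le> t}}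
        \<le> exp (- (\<eta> * (c - 1) / 4 * t))"
      using discovered_lower_tail_given[OF sub t] w by (simp add: discovered_def)
  qed auto
  also have "\<eta> * (c - 1) / 4 * t / M \<le> \<eta> * (c - 1) / 4 * t / 1"
    using M eta c by (intro divide_left_mono) auto
  then have "exp (- (\<eta> * (c - 1) / 4 * t)) \<le> exp (- (\<eta> * (c - 1) / 4 * t / M))" by simp
  finally show ?thesis by simp
qed

text \<open>Every factor is at most an exponential, and the exponents add up through
  \<open>sum_sq'\<close> to slope nearly \<open>c\<close>; reducing it to \<open>(c + 1) / 2\<close>
  absorbs the second-order errors up to \<open>\<eta> / M\<close>.\<close>

lemma extinction_fun_upper:
  assumes "0 \<le> s" "s \<le> \<eta> / M"
  shows "f (1 - s) \<le> 1 - (c + 1) / 2 * s"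
proof -
  define v where "v = c * s * (1 - \<eta> / 2)"
  have s\<eta>: "s \<le> \<eta>"
    using assms(2) M eta divide_left_mono[of 1 M \<eta>] by simp
  have "f (1 - s) = (\<Prod>i<m. 1 - p i * (1 - (1 - p i * s) ^ n))"
    by (simp add: extinction_fun_def)
  also have "\<dots> \<le> (\<Prod>i<m. exp (- ((p i)\<^sup>2 * (n * s * (1 - \<eta> / 2)))))"
  proof (rule prod_mono)
    fix i assume "i \<in> {..<m}"
    then have i: "i < m" by simp
    have nps: "n * (p i * s) \<le> \<eta>"
    proof -
      have "n * (p i * s) = (n * p i) * s" by simp
      also have "\<dots> \<le> M * (\<eta> / M)"
        using p_le_M[OF i] prob[OF i] assms M by (intro mult_mono) auto
      finally show ?thesis using M by simp
    qed
    have s1: "p i * s \<le> 1" using mult_mono[of "p i" 1 s 1] prob[OF i] assms s\<eta> eta by simp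
    have "0 \<le> (1 - p i * s) ^ n" "(1 - p i * s) ^ n \<le> 1"
      using s1 prob[OF i] assms by (auto intro!: power_le_one)
    then have "p i * (1 - (1 - p i * s) ^ n) \<le> 1 * 1"
      using prob[OF i] by (intro mult_mono) auto
    moreover have "(p i)\<^sup>2 * (n * s * (1 - \<eta> / 2)) \<le> p i * (1 - (1 - p i * s) ^ n)"
    proof -
      have "n * (p i * s) * (1 - \<eta> / 2) \<le> 1 - exp (- (n * (p i * s)))"
        using prob[OF i] assms nps by (intro one_minus_exp_ge_linear) auto
      also have "\<dots> \<le> 1 - (1 - p i * s) ^ n"
        using power_one_minus_le_exp[OF s1, of n] by simp
      finally have "p i * (n * (p i * s) * (1 - \<eta> / 2)) \<le> p i * (1 - (1 - p i * s) ^ n)"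
        using prob[OF i] by (intro mult_left_mono) auto
      then show ?thesis by (simp add: power2_eq_square ac_simps)
    qed
    ultimately show "0 \<le> 1 - p i * (1 - (1 - p i * s) ^ n) \<and>
        1 - p i * (1 - (1 - p i * s) ^ n) \<le> exp (- ((p i)\<^sup>2 * (n * s * (1 - \<eta> / 2))))"
      using exp_ge_add_one_self[of "- ((p i)\<^sup>2 * (n * s * (1 - \<eta> / 2)))"] by auto
  qed
  also have "\<dots> = exp (- v)"
    using n by (simp add: exp_sum[symmetric] sum_negf sum_distrib_right[symmetric] sum_sq' v_def)
  also have "\<dots> \<le> 1 - v * (1 - c * \<eta> / 2)"
  proof -
    have "v \<le> c * s * 1" unfolding v_def using c assms eta by (intro mult_left_mono) auto
    also have "\<dots> \<le> c * \<eta>" using s\<eta> c by simp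
    finally have "v \<le> c * \<eta>" .
    moreover have "0 \<le> v" using c assms eta by (auto simp: v_def)
    ultimately show ?thesis using one_minus_exp_ge_linear[of v "c * \<eta>"] by simp
  qed
  also have "v * (1 - c * \<eta> / 2) \<ge> (c + 1) / 2 * s"
  proof -
    have "(c + 1) / 2 * s \<le> (c - c * (c * \<eta>)) * s"
      using eta(4) assms by (intro mult_right_mono) auto
    also have "\<dots> = c * s * (1 - c * \<eta>)" by (simp add: algebra_simps)
    also have "\<dots> \<le> c * s * ((1 - \<eta> / 2) * (1 - c * \<eta> / 2))"
      using c assms eta_factors by (intro mult_left_mono) (auto simp: mult.commute)
    finally show ?thesis by (simp add: v_def ac_simps)
  qed
  then have "1 - v * (1 - c * \<eta> / 2) \<le> 1 - (c + 1) / 2 * s" by simp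
  finally show ?thesis .
qed

text \<open>
  Each attribute contributes at most \<open>6 * (p i)\<^sup>2\<close> to the difference between the exponents of the
  mean and of \<open>f\<close>; since \<open>n\<close> times the sum of the \<open>(p i)\<^sup>2\<close> is \<open>c\<close>, the total bias is only \<open>6 * c\<close>.
  After taking logarithms, the product over the discovered attributes becomes a sum to which
  Hoeffding's inequality applies.
\<close>

lemma discovered_concentration:
  assumes t: "t \<le> n" and half: "\<And>i. i < m \<Longrightarrow> p i \<le> 1 / 2" and z: "z > 0"
  shows "measure_pmf.prob (pair_pmf B B)
      {(R, I). \<bar>card (discovered n R I t) - n * (1 - f (1 - t / n))\<bar> \<ge> 6 * c + 2 * z}
     \<le> 2 * exp (- (z\<^sup>2 / (2 * c * n))) + 2 * exp (- (2 * z\<^sup>2 / n))"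
proof -
  \<comment> \<open>With these weights \<open>exp (- S R)\<close> is the conditional probability
    that a vertex misses all found attributes, and the \<open>b i\<close> express
    \<open>f (1 - t / n)\<close> in the same form.\<close>
  define a where "a i = - ln (1 - p i)" for i
  define r where "r i = 1 - (1 - p i) ^ t" for i
  define r' where "r' i = 1 - (1 - p i * (t / n)) ^ n" for i
  define b where "b i = - ln (1 - p i * r' i)" for i
  define S where "S R = (\<Sum>i<m. if i \<in> R `` {..<t} then a i else 0)" for R :: "(nat \<times> nat) set"
  define ES where "ES = (\<Sum>i<m. r i * a i)"
  have p0: "0 \<le> p i" "p i \<le> 1 / 2" if "i < m" for i using prob[OF that] half[OF that] by auto
  have a: "p i \<le> a i" "a i \<le> p i + 2 * (p i)\<^sup>2" if "i < m" for i
    using ln_one_minus_pos_lower_bound[of "p i"] ln_le_minus_one[of "1 - p i"] p0[OF that]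
    by (auto simp: a_def)
  have a2: "a i \<le> 2 * p i" if "i < m" for i
  proof -
    have "(p i)\<^sup>2 \<le> 1 / 2 * p i"
      unfolding power2_eq_square using p0[OF that] by (intro mult_right_mono) auto
    then show ?thesis using a(2)[OF that] by simp
  qed
  have a0: "0 \<le> a i" if "i < m" for i using a[OF that] p0[OF that] by simp
  have sum_a: "(\<Sum>i<m. (a i)\<^sup>2) \<le> 4 * c / n" "0 < (\<Sum>i<m. (a i)\<^sup>2)"
  proof -
    have "(\<Sum>i<m. (a i)\<^sup>2) \<le> (\<Sum>i<m. (2 * p i)\<^sup>2)"
      using a2 a0 by (intro sum_mono power_mono) auto
    then show "(\<Sum>i<m. (a i)\<^sup>2) \<le> 4 * c / n"
      using sum_sq' by (simp add: power_mult_distrib sum_distrib_left[symmetric])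
    have "0 < c / n" using c n by simp
    also have "\<dots> = (\<Sum>i<m. (p i)\<^sup>2)" using sum_sq' by simp
    also have "\<dots> \<le> (\<Sum>i<m. (a i)\<^sup>2)"
      using a p0 by (intro sum_mono power_mono) auto
    finally show "0 < (\<Sum>i<m. (a i)\<^sup>2)" .
  qed
  \<comment> \<open>\<open>r i\<close> and \<open>r' i\<close> are compared through the same
    exponential: both \<open>1 - r i\<close> and \<open>1 - r' i\<close> lie in a window of width
    \<open>2 * p i\<close>, uniformly in \<open>t\<close> because
    \<open>x * exp (- x) \<le> 1\<close>.\<close>
  have r_bounds: "exp (- (real t * p i)) - 2 * p i \<le> 1 - r i" "1 - r i \<le> exp (- (real t * p i))"
    "exp (- (real t * p i)) - 2 * p i \<le> 1 - r' i" "1 - r' i \<le> exp (- (real t * p i))"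
    if i: "i < m" for i
  proof -
    let ?x = "real t * p i"
    have x0: "0 \<le> ?x" using p0[OF i] by simp
    have low: "exp (- ?x) - 2 * p i \<le> exp (- (?x + 2 * p i * ?x))"
    proof -
      have "?x \<le> exp ?x" using exp_ge_add_one_self[of ?x] by linarith
      then have "exp (- ?x) * ?x \<le> exp (- ?x) * exp ?x" by (intro mult_left_mono) auto
      then have "exp (- ?x) * ?x \<le> 1" by (simp flip: exp_add)
      then have "2 * p i * (exp (- ?x) * ?x) \<le> 2 * p i * 1" using p0[OF i] by (intro mult_left_mono) auto
      then have "exp (- ?x) - 2 * p i \<le> exp (- ?x) * (1 + - (2 * p i * ?x))"
        by (simp add: algebra_simps)
      also have "\<dots> \<le> exp (- ?x) * exp (- (2 * p i * ?x))"
        by (intro mult_left_mono exp_ge_add_one_self) auto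
      also have "\<dots> = exp (- (?x + 2 * p i * ?x))" by (simp flip: exp_add)
      finally show ?thesis .
    qed
    show "1 - r i \<le> exp (- ?x)"
      using power_one_minus_le_exp[of "p i" t] p0[OF i] by (simp add: r_def)
    have "exp (- (?x + 2 * p i * ?x)) \<le> 1 - r i"
      using exp_le_power_one_minus[of "p i" t] p0[OF i]
      by (simp add: r_def algebra_simps power2_eq_square)
    then show "exp (- ?x) - 2 * p i \<le> 1 - r i" using low by simp
    let ?y = "p i * (t / n)"
    have tn: "0 \<le> t / n" "t / n \<le> 1" using t n by auto
    have y: "0 \<le> ?y" "?y \<le> p i" using p0[OF i] tn mult_left_mono[OF tn(2), of "p i"] by auto
    have ny: "n * ?y = ?x" using n by simp
    show "1 - r' i \<le> exp (- ?x)"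
      using power_one_minus_le_exp[of ?y n] y p0[OF i] ny unfolding r'_def by simp
    have "n * (?y + 2 * ?y\<^sup>2) = ?x + 2 * (?y * ?x)"
      using ny by (simp add: power2_eq_square distrib_left mult.left_commute)
    also have "\<dots> \<le> ?x + 2 * (p i * ?x)" using mult_right_mono[OF y(2) x0] by simp
    finally have "exp (- (?x + 2 * p i * ?x)) \<le> exp (- (n * (?y + 2 * ?y\<^sup>2)))" by simp
    also have "\<dots> \<le> (1 - ?y) ^ n" using y(2) p0(2)[OF i] by (intro exp_le_power_one_minus y(1)) linarith
    finally show "exp (- ?x) - 2 * p i \<le> 1 - r' i" using low by (simp add: r'_def)
  qed
  have r01: "0 \<le> r i" "r i \<le> 1" "0 \<le> r' i" "r' i \<le> 1" if i: "i < m" for i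
  proof -
    have tn: "0 \<le> t / n" "t / n \<le> 1" using t n by auto
    have "p i * (t / n) \<le> 1 * 1" using p0[OF i] tn by (intro mult_mono) auto
    then show "0 \<le> r i" "r i \<le> 1" "0 \<le> r' i" "r' i \<le> 1"
      using p0[OF i] tn by (auto simp: r_def r'_def intro!: power_le_one)
  qed
  \<comment> \<open>The constant 6 is made of three errors of \<open>2 * (p i)\<^sup>2\<close>:
    replacing \<open>a i\<close> by \<open>p i\<close>, \<open>r i\<close> by \<open>r' i\<close>,
    and \<open>p i * r' i\<close> by \<open>b i\<close>.\<close>
  have ES_b: "\<bar>ES - (\<Sum>i<m. b i)\<bar> \<le> 6 * c / n"
  proof -
    have "\<bar>r i * a i - b i\<bar> \<le> 6 * (p i)\<^sup>2" if i: "i < m" for i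
    proof -
      have pr: "0 \<le> p i * r' i" "p i * r' i \<le> p i"
        using p0[OF i] r01[OF i] mult_left_mono[of "r' i" 1 "p i"] by auto
      have "p i * r' i \<le> b i" "b i \<le> p i * r' i + 2 * (p i * r' i)\<^sup>2"
        using ln_one_minus_pos_lower_bound[of "p i * r' i"] ln_le_minus_one[of "1 - p i * r' i"] pr p0[OF i]
        by (auto simp: b_def)
      moreover have "(p i * r' i)\<^sup>2 \<le> (p i)\<^sup>2" using pr by (intro power_mono) auto
      moreover have "\<bar>r i * a i - r i * p i\<bar> \<le> 2 * (p i)\<^sup>2"
      proof -
        have "\<bar>r i * a i - r i * p i\<bar> = r i * (a i - p i)"
          using r01[OF i] a[OF i] by (simp add: abs_mult flip: right_diff_distrib)
        also have "\<dots> \<le> 1 * (2 * (p i)\<^sup>2)" using r01[OF i] a[OF i] by (intro mult_mono) auto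
        finally show ?thesis by simp
      qed
      moreover have "\<bar>r i * p i - p i * r' i\<bar> \<le> 2 * (p i)\<^sup>2"
      proof -
        have "\<bar>r i * p i - p i * r' i\<bar> = p i * \<bar>r i - r' i\<bar>"
          using p0[OF i] by (simp add: abs_mult mult.commute flip: right_diff_distrib)
        also have "\<dots> \<le> p i * (2 * p i)" using r_bounds[OF i] p0[OF i] by (intro mult_left_mono) auto
        finally show ?thesis by (simp add: power2_eq_square)
      qed
      ultimately show ?thesis by linarith
    qed
    then have "(\<Sum>i<m. \<bar>r i * a i - b i\<bar>) \<le> (\<Sum>i<m. 6 * (p i)\<^sup>2)" by (intro sum_mono) auto
    moreover have "\<bar>ES - (\<Sum>i<m. b i)\<bar> \<le> (\<Sum>i<m. \<bar>r i * a i - b i\<bar>)"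
      unfolding ES_def sum_subtractf[symmetric] by (rule sum_abs)
    ultimately show ?thesis by (simp add: sum_distrib_left[symmetric] sum_sq')
  qed
  have f_b: "f (1 - t / n) = exp (- (\<Sum>i<m. b i))"
  proof -
    have "exp (- b i) = 1 - p i * r' i" if i: "i < m" for i
    proof -
      have "p i * r' i \<le> 1 / 2 * 1" using p0[OF i] r01[OF i] by (intro mult_mono) auto
      then show ?thesis by (simp add: b_def)
    qed
    then show ?thesis
      by (simp add: exp_sum sum_negf[symmetric] extinction_fun_def r'_def)
  qed
  have b0: "0 \<le> (\<Sum>i<m. b i)"
  proof (rule sum_nonneg)
    fix i assume "i \<in> {..<m}"
    then have i: "i < m" by simp
    have "0 \<le> p i * r' i" "p i * r' i \<le> 1 / 2 * 1"
      using p0[OF i] r01[OF i] mult_mono[of "p i" "1 / 2" "r' i" 1] by auto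
    then show "0 \<le> b i" by (auto simp: b_def)
  qed
  have ES0: "0 \<le> ES" unfolding ES_def using r01 a0 by (auto intro!: sum_nonneg)
  have S0: "0 \<le> S R" for R unfolding S_def using a0 by (auto intro!: sum_nonneg)
  have prob_S: "measure_pmf.prob B {R. \<bar>S R - ES\<bar> \<ge> z / n} \<le> 2 * exp (- (z\<^sup>2 / (2 * c * n)))"
  proof -
    have S_eq: "S = hit_sum {..<m} (\<lambda>i. {..<t} \<times> {i}) a"
      by (auto simp: hit_sum_def hit_attribute_iff S_def fun_eq_iff intro!: sum.cong)
    have "measure_pmf.prob B {R. \<bar>S R - ES\<bar> \<ge> z / n}
        \<le> 2 * exp (- 2 * (z / n)\<^sup>2 / (\<Sum>i<m. (a i)\<^sup>2))"
      unfolding B_def ES_def r_def S_eq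
      by (rule hit_sum_Hoeffding[where p = p and S = "\<lambda>i. {..<t} \<times> {i}", unfolded prod_column])
        (use prob t a0 sum_a z in \<open>auto simp: disjoint_family_on_def\<close>)
    also have "2 * (z / n)\<^sup>2 / (4 * c / n) \<le> 2 * (z / n)\<^sup>2 / (\<Sum>i<m. (a i)\<^sup>2)"
      by (rule divide_left_mono[OF sum_a(1)]) (use sum_a(2) c n in auto)
    then have "2 * exp (- 2 * (z / n)\<^sup>2 / (\<Sum>i<m. (a i)\<^sup>2)) \<le> 2 * exp (- 2 * (z / n)\<^sup>2 / (4 * c / n))"
      by (simp only: mult_minus_left minus_divide_left[symmetric] exp_le_cancel_iff neg_le_iff_le
          mult_le_cancel_left_pos[OF zero_less_numeral])
    also have "2 * (z / n)\<^sup>2 / (4 * c / n) = z\<^sup>2 / (2 * c * n)"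
      using c n by (simp add: power2_eq_square)
    then have "2 * exp (- 2 * (z / n)\<^sup>2 / (4 * c / n)) = 2 * exp (- (z\<^sup>2 / (2 * c * n)))" by simp
    finally show ?thesis .
  qed
  show ?thesis
  \<comment> \<open>A deviation of \<open>S R\<close> below \<open>z / n\<close> shifts the
    conditional mean by at most \<open>z + 6 * c\<close>; the remaining \<open>z\<close> is left to
    the second copy.\<close>
  proof (rule prob_pair_pmf_le[OF prob_S])
    fix R assume R: "R \<in> set_pmf B" and dev: "R \<notin> {R. \<bar>S R - ES\<bar> \<ge> z / n}"
    define U where "U = R `` {..<t}"
    have U: "U \<subseteq> {..<m}" using random_bipartite_subset[of R n m p] R by (auto simp: B_def U_def)
    then have finU: "finite U" using finite_subset by auto
    define q where "q = 1 - (\<Prod>i\<in>U. 1 - p i)"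
    have SU: "S R = (\<Sum>i\<in>U. a i)"
      unfolding S_def U_def[symmetric] using U by (simp add: sum.If_cases Int_absorb1)
    have "exp (- S R) = (\<Prod>i\<in>U. exp (- a i))"
      unfolding SU sum_negf[symmetric] using finU by (rule exp_sum)
    also have "\<dots> = (\<Prod>i\<in>U. 1 - p i)"
    proof (rule prod.cong)
      fix i assume "i \<in> U"
      then have "p i \<le> 1 / 2" using U p0 by auto
      then show "exp (- a i) = 1 - p i" by (simp add: a_def)
    qed simp
    finally have q: "q = 1 - exp (- S R)" by (simp add: q_def)
    have "\<bar>exp (- S R) - f (1 - t / n)\<bar> \<le> \<bar>exp (- S R) - exp (- ES)\<bar> + \<bar>exp (- ES) - exp (- (\<Sum>i<m. b i))\<bar>"
      unfolding f_b by simp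
    also have "\<dots> \<le> \<bar>S R - ES\<bar> + \<bar>ES - (\<Sum>i<m. b i)\<bar>"
      by (intro add_mono abs_exp_minus_diff_le S0 ES0 b0)
    also have "\<dots> \<le> z / n + 6 * c / n" using dev ES_b by auto
    finally have "n * \<bar>exp (- S R) - f (1 - t / n)\<bar> \<le> n * (z / n + 6 * c / n)"
      by (intro mult_left_mono) auto
    then have bias: "\<bar>n * q - n * (1 - f (1 - t / n))\<bar> \<le> z + 6 * c"
      using n unfolding q by (simp add: distrib_left abs_mult flip: right_diff_distrib)
        (simp add: abs_minus_commute)
    have card_eq: "real (card (discovered n R I t)) = hit_sum {..<n} (\<lambda>x. {x} \<times> U) (\<lambda>_. 1) I" for I
    proof -
      have "I \<inter> {x} \<times> U = {} \<longleftrightarrow> I `` {x} \<inter> U = {}" for x by auto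
      then show ?thesis
        by (simp add: hit_sum_def sum.If_cases Int_def conj_commute discovered_def U_def)
    qed
    have "measure_pmf.prob B {I. (R, I) \<in> {(R, I). \<bar>card (discovered n R I t) - n * (1 - f (1 - t / n))\<bar> \<ge> 6 * c + 2 * z}}
       \<le> measure_pmf.prob B {I. \<bar>hit_sum {..<n} (\<lambda>x. {x} \<times> U) (\<lambda>_. 1) I - (\<Sum>x<n. q * 1)\<bar> \<ge> z}"
      using bias by (intro measure_pmf.finite_measure_mono) (auto simp: card_eq)
    also have "\<dots> \<le> 2 * exp (- 2 * z\<^sup>2 / (\<Sum>x<n. 1\<^sup>2))"
      unfolding B_def q_def
      by (rule hit_sum_Hoeffding[where p = p and S = "\<lambda>x. {x} \<times> U", unfolded prod_row])
        (use prob U z n in \<open>auto simp: disjoint_family_on_def\<close>)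
    finally show "measure_pmf.prob B {I. (R, I) \<in> {(R, I). \<bar>card (discovered n R I t) - n * (1 - f (1 - t / n))\<bar> \<ge> 6 * c + 2 * z}}
       \<le> 2 * exp (- (2 * z\<^sup>2 / n))"
      by simp
  qed auto
qed

end

section \<open>The fixed point of the extinction function\<close>

text \<open>Monotonicity is carried along because a product of two nonnegative convex functions is
  convex when both are monotone in the same direction.\<close>

lemma convex_mono_prod:
  fixes g :: "'i \<Rightarrow> real \<Rightarrow> real"
  assumes "finite A" "convex S"
    and "\<And>i. i \<in> A \<Longrightarrow> convex_on S (g i)" "\<And>i. i \<in> A \<Longrightarrow> mono_on S (g i)"
    and "\<And>i x. i \<in> A \<Longrightarrow> x \<in> S \<Longrightarrow> 0 \<le> g i x"
  shows "convex_on S (\<lambda>x. \<Prod>i\<in>A. g i x) \<and> mono_on S (\<lambda>x. \<Prod>i\<in>A. g i x)"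
  using assms
proof (induction A rule: finite_induct)
  case empty
  then show ?case by (simp add: convex_on_const mono_on_def)
next
  case (insert i A)
  have IH: "convex_on S (\<lambda>x. \<Prod>i\<in>A. g i x)" "mono_on S (\<lambda>x. \<Prod>i\<in>A. g i x)"
    using insert by auto
  have nn: "0 \<le> (\<Prod>i\<in>A. g i x)" if "x \<in> S" for x
    using insert.prems(4) that by (intro prod_nonneg) auto
  have "convex_on S (\<lambda>x. g i x * (\<Prod>i\<in>A. g i x))"
    using insert.prems IH nn by (intro convex_on_mul) auto
  moreover have "mono_on S (\<lambda>x. g i x * (\<Prod>i\<in>A. g i x))"
  proof (rule mono_onI)
    fix x y assume "x \<in> S" "y \<in> S" "x \<le> y"
    then show "g i x * (\<Prod>i\<in>A. g i x) \<le> g i y * (\<Prod>i\<in>A. g i y)"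
      using insert.prems(3)[of i] insert.prems(4)[of i] IH(2) nn
      by (intro mult_mono) (auto dest: mono_onD)
  qed
  ultimately show ?case using insert.hyps by simp
qed

context rig_params
begin

text \<open>Each factor is rewritten as \<open>1 - p i + p i * (1 - p i + p i * x) ^ n\<close>,
  built from products and nonnegative affine combinations, so that convexity and monotonicity
  propagate.\<close>

lemma convex_extinction_fun: "convex_on {0..1} f"
proof -
  have affine: "convex_on {0..1} (\<lambda>x. a + b * h x) \<and> mono_on {0..1} (\<lambda>x. a + b * h x)"
    if "convex_on {0..1} h" "mono_on {0..1} h" "0 \<le> b" for a b :: real and h :: "real \<Rightarrow> real"
  proof
    show "convex_on {0..1} (\<lambda>x. a + b * h x)"
      using that by (intro convex_on_add convex_on_cmul) (auto simp: convex_on_const)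
    show "mono_on {0..1} (\<lambda>x. a + b * h x)"
      using that by (auto simp: mono_on_def intro!: mult_left_mono)
  qed
  have pw: "convex_on {0..1} (\<lambda>x. (1 - p i + p i * x) ^ n) \<and> mono_on {0..1} (\<lambda>x. (1 - p i + p i * x) ^ n)"
    if i: "i < m" for i
  proof -
    have "convex_on {0..1} (\<lambda>x. \<Prod>j<n. 1 - p i + p i * x) \<and> mono_on {0..1} (\<lambda>x. \<Prod>j<n. 1 - p i + p i * x)"
      using affine[of "\<lambda>x. x" "p i" "1 - p i"] prob[OF i]
      by (intro convex_mono_prod) (auto simp: convex_on_ident mono_on_def)
    then show ?thesis by simp
  qed
  have nn: "0 \<le> 1 - p i + p i * (1 - p i + p i * x) ^ n" if "i < m" "x \<in> {0..1}" for i x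
    using prob[OF that(1)] that(2) by (intro add_nonneg_nonneg mult_nonneg_nonneg zero_le_power) auto
  have "convex_on {0..1} (\<lambda>x. \<Prod>i<m. 1 - p i + p i * (1 - p i + p i * x) ^ n)"
    using affine pw prob nn by (intro convex_mono_prod[THEN conjunct1]) auto
  moreover have "(\<lambda>x. \<Prod>i<m. 1 - p i + p i * (1 - p i + p i * x) ^ n) = f"
    by (auto simp: extinction_fun_def fun_eq_iff algebra_simps intro!: prod.cong)
  ultimately show ?thesis by simp
qed

text \<open>
  \<open>n * excess (t / n)\<close> is the expected surplus of discovered over explored vertices at time \<open>t\<close>.
  It is a concave function of \<open>t\<close>, with zeros \<open>0\<close> and \<open>n * (1 - \<rho>)\<close>.
\<close>

definition "excess s = 1 - f (1 - s) - s"

text \<open>Concavity as a chord inequality cleared of denominators; it can be read as a bound at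
  any of the three points.\<close>

lemma excess_three_points:
  assumes "0 \<le> x" "x \<le> y" "y \<le> z" "z \<le> 1"
  shows "excess x * (z - y) + excess z * (y - x) \<le> excess y * (z - x)"
proof (cases "x = z")
  case False
  then have xz: "z - x > 0" using assms by simp
  define t where "t = (z - y) / (z - x)"
  have t: "0 \<le> t" "t \<le> 1" "t * (z - x) = z - y" "(1 - t) * (z - x) = y - x"
    using xz assms by (auto simp: t_def field_simps)
  have "1 - y = (1 - t) * (1 - z) + t * (1 - x)"
    using t(3) by (simp add: algebra_simps)
  then have "f (1 - y) \<le> (1 - t) * f (1 - z) + t * f (1 - x)"
    using convex_onD[OF convex_extinction_fun t(1,2), of "1 - z" "1 - x"] assms by simp
  then have "f (1 - y) * (z - x) \<le> ((1 - t) * f (1 - z) + t * f (1 - x)) * (z - x)"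
    using xz by (intro mult_right_mono) auto
  also have "\<dots> = ((1 - t) * (z - x)) * f (1 - z) + (t * (z - x)) * f (1 - x)"
    by (simp add: algebra_simps)
  also have "\<dots> = (y - x) * f (1 - z) + (z - y) * f (1 - x)" unfolding t ..
  finally show ?thesis by (simp add: excess_def algebra_simps)
qed (use assms in auto)

text \<open>\<open>n * s0\<close> is the end of the range of \<open>discovered_lower_tail\<close>;
  the height \<open>excess s0\<close> serves as the unit for all later estimates.\<close>

definition "s0 = \<eta> / M"

lemma s0: "0 < s0" "s0 \<le> 1"
proof -
  show "0 < s0" using eta M by (simp add: s0_def)
  have "s0 \<le> \<eta> / 1" unfolding s0_def using eta M by (intro divide_left_mono) auto
  then show "s0 \<le> 1" using eta by simp
qed

lemma excess_s0: "(c - 1) / 2 * s0 \<le> excess s0" "0 < excess s0"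
proof -
  have "f (1 - s0) \<le> 1 - (c + 1) / 2 * s0"
    by (rule extinction_fun_upper) (use s0 in \<open>auto simp: s0_def\<close>)
  then show le: "(c - 1) / 2 * s0 \<le> excess s0"
    by (simp add: excess_def field_simps)
  have "0 < (c - 1) / 2 * s0" using c s0 by simp
  then show "0 < excess s0" using le by linarith
qed

lemma excess_0: "excess 0 = 0"
  by (simp add: excess_def extinction_fun_def)

lemma ex_fixed_point: "\<exists>x. 0 \<le> x \<and> x < 1 \<and> x = f x"
proof -
  have "continuous_on {0..1 - s0} (\<lambda>x. f x - x)"
    unfolding extinction_fun_def by (intro continuous_intros)
  moreover have "0 \<le> f 0"
    unfolding extinction_fun_def
  proof (rule prod_nonneg)
    fix i assume "i \<in> {..<m}"
    then have "p i * (1 - (1 - p i * (1 - 0)) ^ n) \<le> 1 * 1"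
      using prob[of i] by (intro mult_mono) (auto intro!: power_le_one)
    then show "0 \<le> 1 - p i * (1 - (1 - p i * (1 - 0)) ^ n)" by simp
  qed
  moreover have "f (1 - s0) - (1 - s0) \<le> 0"
    using excess_s0 by (simp add: excess_def)
  ultimately obtain x where "0 \<le> x" "x \<le> 1 - s0" "f x - x = 0"
    using IVT2'[of "\<lambda>x. f x - x" "1 - s0" 0 0] s0 by auto
  then show ?thesis using s0 by (intro exI[of _ x]) auto
qed

text \<open>Otherwise concavity, with zeros of \<open>excess\<close> at 0 and \<open>1 - x\<close>,
  would make it nonpositive at \<open>s0\<close>.\<close>

lemma s0_less_survival:
  assumes "0 \<le> x" "x < 1" "x = f x"
  shows "s0 < 1 - x"
proof (rule ccontr)
  assume "\<not> s0 < 1 - x"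
  moreover have "excess (1 - x) = 0" using assms by (simp add: excess_def)
  ultimately have "excess s0 * (1 - x) \<le> 0"
    using excess_three_points[of 0 "1 - x" s0] assms s0 excess_0 by auto
  then show False using excess_s0(2) assms by (auto simp: mult_le_0_iff)
qed

lemma fixed_point_unique:
  assumes x: "0 \<le> x" "x < 1" "x = f x" and y: "0 \<le> y" "y < 1" "y = f y"
  shows "x = y"
proof -
  have False if "0 \<le> x" "x < 1" "x = f x" "0 \<le> y" "y < 1" "y = f y" "x < y" for x y
  proof -
    have "excess (1 - x) = 0" "excess (1 - y) = 0" using that by (auto simp: excess_def)
    then have "excess s0 * (y - x) \<le> 0"
      using excess_three_points[of s0 "1 - y" "1 - x"] s0_less_survival[of y] that s0 by auto
    then show False using excess_s0(2) that by (auto simp: mult_le_0_iff)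
  qed
  then show ?thesis using x y by (metis linorder_neqE_linordered_idom)
qed

section \<open>Quantitative bounds for the excess on both sides of its zero\<close>

context
  fixes \<rho> \<epsilon> :: real
  assumes \<rho>: "0 \<le> \<rho>" "\<rho> < 1" "\<rho> = f \<rho>" and \<epsilon>: "0 < \<epsilon>" "\<epsilon> \<le> 1 / 4"
begin

lemma excess_survival: "excess (1 - \<rho>) = 0"
  using \<rho> by (simp add: excess_def)

text \<open>Up to its zero at \<open>1 - \<rho>\<close> the function lies above the chord from
  \<open>(s0, excess s0)\<close> to that zero.\<close>

lemma excess_before:
  assumes "s0 \<le> s" "s \<le> (1 - \<epsilon>) * (1 - \<rho>)"
  shows "\<epsilon> * excess s0 \<le> excess s"
proof (rule ccontr)
  assume neg: "\<not> ?thesis"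
  have d: "0 < 1 - \<rho> - s0" using s0_less_survival[OF \<rho>] by simp
  have "(1 - \<epsilon>) * (1 - \<rho>) \<le> 1 * (1 - \<rho>)"
    using \<epsilon> \<rho>(2) by (intro mult_right_mono) auto
  then have s: "s \<le> 1 - \<rho>" using assms(2) by simp
  have "excess s0 * (\<epsilon> * (1 - \<rho>)) \<le> excess s0 * (1 - \<rho> - s)"
    using assms excess_s0(2) by (intro mult_left_mono) (auto simp: algebra_simps)
  also have "\<dots> \<le> excess s * (1 - \<rho> - s0)"
    using excess_three_points[of s0 s "1 - \<rho>"] assms s \<rho> s0 excess_survival by simp
  also have "\<dots> < \<epsilon> * excess s0 * (1 - \<rho> - s0)"
    using neg d by (intro mult_strict_right_mono) auto
  also have "\<dots> \<le> \<epsilon> * excess s0 * (1 - \<rho>)"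
    using \<epsilon> excess_s0 s0 by (intro mult_left_mono) auto
  finally show False by (simp add: ac_simps)
qed

text \<open>Beyond the zero the function lies below the extension of the same chord, whose slope is
  steeper than \<open>- excess s0 / (1 - \<rho>)\<close>.\<close>

lemma excess_after:
  assumes "(1 + \<delta>) * (1 - \<rho>) \<le> s" "s \<le> 1" "0 \<le> \<delta>"
  shows "excess s \<le> - (\<delta> * excess s0)"
proof (rule ccontr)
  assume neg: "\<not> ?thesis"
  have d: "0 < 1 - \<rho> - s0" using s0_less_survival[OF \<rho>] by simp
  have "1 * (1 - \<rho>) \<le> (1 + \<delta>) * (1 - \<rho>)"
    using assms(3) \<rho>(2) by (intro mult_right_mono) auto
  then have s: "1 - \<rho> \<le> s" using assms(1) by simp
  have "- (\<delta> * excess s0) * (1 - \<rho>) \<le> - (\<delta> * excess s0) * (1 - \<rho> - s0)"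
    using assms excess_s0 s0 by (intro mult_left_mono_neg) auto
  also have "\<dots> < excess s * (1 - \<rho> - s0)"
    using neg d by (intro mult_strict_right_mono) auto
  also have "\<dots> \<le> - (excess s0 * (s - (1 - \<rho>)))"
    using excess_three_points[of s0 "1 - \<rho>" s] assms s d s0 excess_survival by simp
  also have "\<delta> * (1 - \<rho>) \<le> s - (1 - \<rho>)" using assms(1) by (simp add: algebra_simps)
  then have "- (excess s0 * (s - (1 - \<rho>))) \<le> - (excess s0 * (\<delta> * (1 - \<rho>)))"
    using excess_s0(2) by simp
  finally show False by (simp add: ac_simps)
qed

text \<open>If \<open>s\<close> is before the zero, \<open>excess s\<close> is nonnegative and
  \<open>s'\<close> is at least \<open>3 / 2 * (1 - \<rho>)\<close>, so \<open>excess_after\<close>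
  applies with factor \<open>1 / 2\<close>. After the zero, concavity bounds the slope by that of
  the chord from \<open>s0\<close> to the zero.\<close>

lemma excess_decrease:
  assumes "(1 - \<epsilon>) * (1 - \<rho>) \<le> s" "s + (1 - \<epsilon>) * (1 - \<rho>) \<le> s'" "s' \<le> 1"
  shows "excess s' - excess s \<le> - (excess s0 / 2)"
proof -
  have big: "3 / 4 * (1 - \<rho>) \<le> (1 - \<epsilon>) * (1 - \<rho>)"
    using \<epsilon> \<rho> by (intro mult_right_mono) auto
  show ?thesis
  proof (cases "s \<le> 1 - \<rho>")
    case True
    have "0 \<le> 3 / 4 * (1 - \<rho>)" using \<rho>(2) by simp
    then have s_nn: "0 \<le> s" using assms(1) big by linarith
    then have "0 \<le> excess s * (1 - \<rho>)"
      using excess_three_points[of 0 s "1 - \<rho>"] True \<rho> excess_0 excess_survival by simp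
    then have "0 \<le> excess s" using \<rho> by (simp add: zero_le_mult_iff)
    moreover have "excess s' \<le> - (1 / 2 * excess s0)"
      using assms big by (intro excess_after) auto
    ultimately show ?thesis by simp
  next
    case False
    have d: "0 < 1 - \<rho> - s0" using s0_less_survival[OF \<rho>] by simp
    then have e: "0 < s - s0" using False by simp
    have nn: "0 \<le> 3 / 4 * (1 - \<rho>)" using \<rho>(2) by simp
    then have ss': "s \<le> s'" using assms(2) big by linarith
    let ?X = "excess s' - excess s"
    have 1: "?X * (s - s0) \<le> (excess s - excess s0) * (s' - s)"
      using excess_three_points[of s0 s s'] assms e ss' s0 by (simp add: algebra_simps)
    have 2: "(excess s - excess s0) * (1 - \<rho> - s0) \<le> - (excess s0 * (s - s0))"
      using excess_three_points[of s0 "1 - \<rho>" s] assms False ss' d s0 excess_survival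
      by (simp add: algebra_simps)
    have "(s - s0) * (?X * (1 - \<rho> - s0)) = (?X * (s - s0)) * (1 - \<rho> - s0)" by simp
    also have "\<dots> \<le> (excess s - excess s0) * (s' - s) * (1 - \<rho> - s0)"
      using 1 d by (intro mult_right_mono) auto
    also have "\<dots> = (s' - s) * ((excess s - excess s0) * (1 - \<rho> - s0))" by simp
    also have "\<dots> \<le> (s' - s) * (- (excess s0 * (s - s0)))"
      using 2 ss' by (intro mult_left_mono) auto
    also have "\<dots> = (s - s0) * (- (excess s0 * (s' - s)))" by simp
    finally have "?X * (1 - \<rho> - s0) \<le> - (excess s0 * (s' - s))"
      using e by (rule mult_left_le_imp_le)
    also have "\<dots> \<le> - (excess s0 * (1 / 2 * (1 - \<rho>)))"
      using assms big \<rho> excess_s0 by (auto intro!: mult_left_mono)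
    also have "\<dots> \<le> - (excess s0 / 2) * (1 - \<rho> - s0)"
      using excess_s0 s0 by (simp add: field_simps)
    finally show ?thesis using d by (rule mult_right_le_imp_le)
  qed
qed

end

end

section \<open>The giant component\<close>

text \<open>
  If the exploration starts at \<open>v\<close>, its first excursion is the component of \<open>v\<close>; a union bound over
  all \<open>v\<close> then controls every component.
\<close>

definition start_at :: "nat \<Rightarrow> nat set \<Rightarrow> nat" where
  "start_at v X = (if v \<in> X then v else (SOME x. x \<in> X))"

lemma selection_start_at: "selection (start_at v)"
  by unfold_locales (auto simp: start_at_def some_in_eq)

text \<open>Components other than the giant are bounded only by \<open>k\<close> here, since one run
  gives the dichotomy for the component of its own starting vertex alone.\<close>

definition component_dichotomy :: "nat \<Rightarrow> nat \<Rightarrow> nat \<Rightarrow> nat \<Rightarrow> nat \<Rightarrow> (nat \<times> nat) set \<Rightarrow> bool" where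
  "component_dichotomy n l k u v E \<longleftrightarrow>
     (\<forall>C\<in>graph_components {..<n} E. v \<in> C \<longrightarrow> card C < l \<or> k < card C) \<and>
     (\<exists>C\<in>graph_components {..<n} E. k < card C + l \<and> card C \<le> u \<and>
        (\<forall>D\<in>graph_components {..<n} E. D \<noteq> C \<longrightarrow> card D \<le> k))"

text \<open>The dichotomy for all \<open>v\<close> covers every component: a size above
  \<open>k - l \<ge> l\<close> must exceed \<open>k\<close>, and a size at most \<open>k\<close>
  must lie below \<open>l\<close>.\<close>

lemma unique_giant:
  assumes dich: "\<And>v. v < n \<Longrightarrow> component_dichotomy n l k u v E" and n: "n \<ge> 1" and lk: "2 * l \<le> k"
  obtains C where "C \<in> graph_components {..<n} E" "k < card C" "card C \<le> u"
    "\<forall>D\<in>graph_components {..<n} E. D \<noteq> C \<longrightarrow> card D < l"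
proof -
  have dichotomy: "card C < l \<or> k < card C" if C: "C \<in> graph_components {..<n} E" for C
  proof -
    obtain v where "v < n" "C = E\<^sup>* `` {v}" using C by (auto simp: graph_components_def quotient_def)
    then show ?thesis using dich[of v] C by (auto simp: component_dichotomy_def)
  qed
  have "component_dichotomy n l k u 0 E" using dich n by auto
  then obtain C where C: "C \<in> graph_components {..<n} E" "k < card C + l" "card C \<le> u"
    and other: "\<And>D. D \<in> graph_components {..<n} E \<Longrightarrow> D \<noteq> C \<Longrightarrow> card D \<le> k"
    unfolding component_dichotomy_def by blast
  show ?thesis
  proof (rule that[OF C(1) _ C(3)])
    show "k < card C" using dichotomy[OF C(1)] C(2) lk by linarith
    show "\<forall>D\<in>graph_components {..<n} E. D \<noteq> C \<longrightarrow> card D < l"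
    proof (intro ballI impI)
      fix D assume "D \<in> graph_components {..<n} E" "D \<noteq> C"
      then show "card D < l" using dichotomy[of D] other[of D] by linarith
    qed
  qed
qed

context rig_params
begin

section \<open>From surplus estimates to component sizes\<close>

lemma expected_discovered: "n * (1 - f (1 - t / n)) = t + n * excess (t / n)"
  using n by (simp add: excess_def field_simps)

text \<open>The tolerated deviation \<open>x\<close> is a quarter of the guaranteed surplus
  \<open>\<epsilon> * n * excess s0\<close>, so it cannot change the sign of the drift, and the
  remaining margin absorbs \<open>l\<close> and the roundings.\<close>

lemma component_dichotomy_of_discovered:
  fixes \<rho> \<epsilon> L x :: real
  assumes \<rho>: "0 \<le> \<rho>" "\<rho> < 1" "\<rho> = f \<rho>" and \<epsilon>: "0 < \<epsilon>" "\<epsilon> \<le> 1 / 4"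
    and RI: "R \<subseteq> {..<n} \<times> {..<m}" "I \<subseteq> {..<n} \<times> {..<m}"
    and L: "0 \<le> L" "L + 2 \<le> x" "L + 2 \<le> n * s0 / 4"
    and x: "x = \<epsilon> * n * excess s0 / 4"
    and low: "\<And>t. t \<le> n \<Longrightarrow> L \<le> t \<Longrightarrow> t \<le> n * s0 \<Longrightarrow> t < card (discovered n R I t)"
    and conc: "\<And>t. t \<le> n \<Longrightarrow> \<bar>card (discovered n R I t) - n * (1 - f (1 - t / n))\<bar> < x"
    and v: "v < n"
  defines "l \<equiv> nat \<lceil>L\<rceil>" and "k \<equiv> nat \<lfloor>(1 - \<epsilon>) * ((1 - \<rho>) * n)\<rfloor>" and "u \<equiv> nat \<lfloor>(1 + \<epsilon>) * ((1 - \<rho>) * n)\<rfloor>"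
  shows "2 * l \<le> k"
    and "component_dichotomy n l k u v (intersection_graph (merged_graph (start_at v) n R I))"
proof -
  interpret exploration "start_at v" n m R I
    using selection_start_at[of v] RI
    by (simp add: exploration_def exploration_axioms_def)
  let ?T = "(1 - \<rho>) * n"
  have T: "0 < ?T" "n * s0 < ?T" "?T \<le> n"
    using s0_less_survival[OF \<rho>] n \<rho>(1,2) by (auto simp: mult.commute)
  have eT: "3 / 4 * ?T \<le> (1 - \<epsilon>) * ?T" "(1 - \<epsilon>) * ?T \<le> 1 * ?T" "1 * ?T \<le> (1 + \<epsilon>) * ?T"
    by (rule mult_right_mono; use \<epsilon> T(1) in linarith)+
  have l: "real l < L + 1" "L \<le> real l" unfolding l_def using L(1) by linarith+
  have k: "real k \<le> (1 - \<epsilon>) * ?T" "(1 - \<epsilon>) * ?T < real k + 1"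
    unfolding k_def using eT T(1) by linarith+
  have u: "real u \<le> (1 + \<epsilon>) * ?T" "(1 + \<epsilon>) * ?T < real u + 1"
    unfolding u_def using eT T(1) by linarith+
  show lk: "2 * l \<le> k"
  proof -
    have "2 * real l < k" using l k eT T L(3) by linarith
    then show ?thesis by linarith
  qed
  have kn: "k \<le> n" using k(1) eT(2) T(3) by linarith
  have nx: "n * excess s0 * \<epsilon> = 4 * x" using x by (simp add: mult.commute mult.left_commute)
  \<comment> \<open>Two regimes: \<open>low\<close> up to \<open>n * s0\<close>, where deviations of
    size \<open>x\<close> could exceed the surplus, and concavity with \<open>conc\<close> from
    there on.\<close>
  have above: "t < card (D t)" if t: "l \<le> t" "t \<le> k" for t
  proof (cases "t \<le> n * s0")
    case True
    then show ?thesis using low[of t] t kn l by auto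
  next
    case False
    have "t / n \<le> (1 - \<epsilon>) * ?T / n" using t k n by (intro divide_right_mono) auto
    then have "t / n \<le> (1 - \<epsilon>) * (1 - \<rho>)" using n by simp
    moreover have "s0 \<le> t / n" using False n by (simp add: field_simps)
    ultimately have "\<epsilon> * excess s0 \<le> excess (t / n)"
      by (intro excess_before[OF \<rho> \<epsilon>])
    then have "n * (\<epsilon> * excess s0) \<le> n * excess (t / n)" by (intro mult_left_mono) auto
    then have "4 * x \<le> n * excess (t / n)" using nx by (simp add: ac_simps)
    then show ?thesis using conc[of t] t kn L unfolding expected_discovered by linarith
  qed
  have ends: "card (D (u + 1)) + l \<le> u" if un: "u < n"
  proof -
    have "(1 + \<epsilon>) * ?T / n \<le> (u + 1) / n" using u by (intro divide_right_mono) auto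
    then have "(1 + \<epsilon>) * (1 - \<rho>) \<le> (u + 1) / n" using n by simp
    moreover have "(u + 1) / n \<le> 1" using un by simp
    ultimately have "excess ((u + 1) / n) \<le> - (\<epsilon> * excess s0)"
      using \<epsilon> by (intro excess_after[OF \<rho> \<epsilon>]) auto
    then have "n * excess ((u + 1) / n) \<le> n * - (\<epsilon> * excess s0)" by (intro mult_left_mono) auto
    then have "n * excess ((u + 1) / n) \<le> - 4 * x" using nx by (simp add: ac_simps)
    moreover have "\<bar>card (D (u + 1)) - ((u + 1) + n * excess ((u + 1) / n))\<bar> < x"
      using conc[of "u + 1", unfolded expected_discovered] un by simp
    ultimately have "card (D (u + 1)) < real (u + 1) - 3 * x" by linarith
    then have "real (card (D (u + 1)) + l) \<le> real u"
      using l(1) L(1,2) unfolding of_nat_add of_nat_1 by linarith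
    then show ?thesis by (simp only: of_nat_le_iff)
  qed
  have after: "card (D b) + a + 1 < card (D a) + b" if ab: "k < a" "a + k < b" "b \<le> n" for a b
  proof -
    have "(1 - \<epsilon>) * ?T / n \<le> a / n" using k ab by (intro divide_right_mono) auto
    then have 1: "(1 - \<epsilon>) * (1 - \<rho>) \<le> a / n" using n by simp
    have "(a + (1 - \<epsilon>) * ?T) / n \<le> b / n" using k ab by (intro divide_right_mono) auto
    then have 2: "a / n + (1 - \<epsilon>) * (1 - \<rho>) \<le> b / n" using n by (simp add: add_divide_distrib)
    have "excess (b / n) - excess (a / n) \<le> - (excess s0 / 2)"
      using ab by (intro excess_decrease[OF \<rho> \<epsilon> 1 2]) auto
    also have "\<dots> \<le> - (2 * \<epsilon> * excess s0)"
      using \<epsilon> excess_s0(2) mult_right_mono[of "2 * \<epsilon>" "1 / 2" "excess s0"] by auto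
    finally have "n * (excess (b / n) - excess (a / n)) \<le> n * - (2 * \<epsilon> * excess s0)"
      by (intro mult_left_mono) auto
    then have "n * excess (b / n) - n * excess (a / n) \<le> - 8 * x"
      using nx by (simp add: algebra_simps)
    moreover have "\<bar>card (D a) - (a + n * excess (a / n))\<bar> < x" "\<bar>card (D b) - (b + n * excess (b / n))\<bar> < x"
      using conc[of a, unfolded expected_discovered] conc[of b, unfolded expected_discovered] ab
      by simp_all
    ultimately have "real (card (D b)) + real a + 6 * x < real (card (D a)) + real b" by linarith
    then have "real (card (D b) + a + 1) < real (card (D a) + b)"
      using L(1,2) unfolding of_nat_add of_nat_1 by linarith
    then show ?thesis by (simp only: of_nat_less_iff)
  qed
  have w0: "w 0 = v"
  proof -
    have "w 0 = start_at v {..<n}"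
      by (simp add: w_def visit_def next_vertex_def Let_def)
    then show ?thesis using v by (simp add: start_at_def)
  qed
  have "l \<le> k" using lk by simp
  from giant_component[of l k u, OF above kn this ends after]
  obtain C where C: "C \<in> graph_components {..<n} E" "k < card C + l" "card C \<le> u"
    "\<forall>C'\<in>graph_components {..<n} E. C' \<noteq> C \<longrightarrow> card C' \<le> k" .
  show "component_dichotomy n l k u v (intersection_graph (merged_graph (start_at v) n R I))"
    unfolding component_dichotomy_def E_def[symmetric]
  proof (intro conjI ballI impI bexI[OF _ C(1)])
    fix C' assume "C' \<in> graph_components {..<n} E" "v \<in> C'"
    then show "card C' < l \<or> k < card C'"
      using first_component_dichotomy[of l k C', OF above kn] unfolding w0 by blast
  qed (use C in auto)
qed

text \<open>\<open>L\<close> makes each early failure probability at most \<open>2 / n ^ 3\<close>.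
  Deviations are bounded with \<open>z = x / 4\<close>, and \<open>12 * c \<le> x\<close> gives
  \<open>6 * c + 2 * z \<le> x\<close>. The union is over \<open>n + 1\<close> times.\<close>

lemma prob_discovered_bad:
  fixes L x :: real
  assumes half: "\<And>i. i < m \<Longrightarrow> p i \<le> 1 / 2"
    and L: "L = 12 / (\<eta> * (c - 1)) * M * ln n"
    and x: "12 * c \<le> x" "3 * ln n \<le> (x / 4)\<^sup>2 / (2 * c * n)"
  defines "bad \<equiv> {(R, I). \<exists>t\<le>n. (L \<le> t \<and> t \<le> n * s0 \<and> card (discovered n R I t) \<le> t) \<or>
      \<bar>card (discovered n R I t) - n * (1 - f (1 - t / n))\<bar> \<ge> x}"
  shows "measure_pmf.prob (pair_pmf B B) bad \<le> 6 * (n + 1) / n ^ 3"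
proof -
  define low where "low t = {(R, I). L \<le> t \<and> t \<le> n * s0 \<and> card (discovered n R I t) \<le> t}" for t :: nat
  define dev where "dev t = {(R, I). \<bar>card (discovered n R I t) - n * (1 - f (1 - t / n))\<bar> \<ge> x}" for t :: nat
  have pow: "exp (- (3 * ln n)) = 1 / n ^ 3"
    using n by (simp add: exp_minus exp_of_nat_mult[of 3 "ln n", simplified] divide_inverse)
  have x0: "x > 0" using x c by linarith
  have low: "measure_pmf.prob (pair_pmf B B) (low t) \<le> 2 / n ^ 3" for t
  proof (cases "L \<le> t \<and> t \<le> n * s0")
    case True
    have "3 * ln n = \<eta> * (c - 1) / 4 * L / M"
      using eta c M by (simp add: L)
    also have "\<dots> \<le> \<eta> * (c - 1) / 4 * t / M"
      using True eta c M by (intro divide_right_mono mult_left_mono) auto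
    finally have "2 * exp (- (\<eta> * (c - 1) / 4 * t / M)) \<le> 2 * exp (- (3 * ln n))" by simp
    moreover have "real t \<le> \<eta> * n / M" using True by (simp add: s0_def mult.commute)
    then have "measure_pmf.prob (pair_pmf B B) {(R, I). card (discovered n R I t) \<le> t}
        \<le> 2 * exp (- (\<eta> * (c - 1) / 4 * t / M))"
      by (rule discovered_lower_tail)
    ultimately show ?thesis using True by (simp add: low_def pow)
  qed (auto simp: low_def)
  have dev: "measure_pmf.prob (pair_pmf B B) (dev t) \<le> 4 / n ^ 3" if t: "t \<le> n" for t
  proof -
    have "(x / 4)\<^sup>2 / (2 * c * n) \<le> 2 * (x / 4)\<^sup>2 / n"
    proof -
      have "(x / 4)\<^sup>2 / (2 * c * n) \<le> (x / 4)\<^sup>2 / n"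
        using c n by (intro divide_left_mono) auto
      moreover have "0 \<le> (x / 4)\<^sup>2 / n" by simp
      ultimately show ?thesis unfolding times_divide_eq_right[symmetric] by linarith
    qed
    then have e: "exp (- (2 * (x / 4)\<^sup>2 / n)) \<le> 1 / n ^ 3" "exp (- ((x / 4)\<^sup>2 / (2 * c * n))) \<le> 1 / n ^ 3"
      using x(2) unfolding pow[symmetric] by simp_all
    have "measure_pmf.prob (pair_pmf B B) (dev t) \<le> measure_pmf.prob (pair_pmf B B)
        {(R, I). \<bar>card (discovered n R I t) - n * (1 - f (1 - t / n))\<bar> \<ge> 6 * c + 2 * (x / 4)}"
      using x(1) by (intro measure_pmf.finite_measure_mono) (auto simp: dev_def)
    also have "\<dots> \<le> 2 * exp (- ((x / 4)\<^sup>2 / (2 * c * n))) + 2 * exp (- (2 * (x / 4)\<^sup>2 / n))"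
      by (rule discovered_concentration[OF t half]) (use x0 in auto)
    also have "\<dots> \<le> 2 * (1 / n ^ 3) + 2 * (1 / n ^ 3)" using e by linarith
    finally show ?thesis by simp
  qed
  have "measure_pmf.prob (pair_pmf B B) bad \<le> measure_pmf.prob (pair_pmf B B) (\<Union>t\<le>n. low t \<union> dev t)"
    by (intro measure_pmf.finite_measure_mono) (auto simp: bad_def low_def dev_def)
  also have "\<dots> \<le> (\<Sum>t\<le>n. measure_pmf.prob (pair_pmf B B) (low t \<union> dev t))"
    by (rule measure_pmf.finite_measure_subadditive_finite) auto
  also have "\<dots> \<le> (\<Sum>t\<le>n. 2 / n ^ 3 + 4 / n ^ 3)"
  proof (rule sum_mono)
    fix t assume "t \<in> {..n}"
    then show "measure_pmf.prob (pair_pmf B B) (low t \<union> dev t) \<le> 2 / n ^ 3 + 4 / n ^ 3"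
      using measure_Un_le[of "low t" "measure_pmf (pair_pmf B B)" "dev t"] low[of t] dev[of t] by auto
  qed
  also have "\<dots> = 6 * (n + 1) / n ^ 3" by (simp add: algebra_simps flip: add_divide_distrib)
  finally show ?thesis .
qed

text \<open>The event \<open>bad\<close> does not involve \<open>v\<close>, but for each
  \<open>v\<close> the merged graph is a different function of \<open>(R, I)\<close> with the same
  law. Failure probabilities are therefore transferred to the random intersection graph for each
  \<open>v\<close> and summed there.\<close>

lemma prob_giant_component:
  fixes \<rho> \<epsilon> L x :: real
  assumes \<rho>: "0 \<le> \<rho>" "\<rho> < 1" "\<rho> = f \<rho>" and \<epsilon>: "0 < \<epsilon>" "\<epsilon> \<le> 1 / 4"
    and half: "\<And>i. i < m \<Longrightarrow> p i \<le> 1 / 2"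
    and L: "L = 12 / (\<eta> * (c - 1)) * M * ln n" "L + 2 \<le> x" "L + 2 \<le> n * s0 / 4"
    and x: "x = \<epsilon> * n * excess s0 / 4" "12 * c \<le> x" "3 * ln n \<le> (x / 4)\<^sup>2 / (2 * c * n)"
  shows "1 - 6 * (n + 1) / n ^ 2 \<le> measure_pmf.prob (random_intersection_graph n m p)
     {E. \<exists>C\<in>graph_components {..<n} E.
        (\<forall>D\<in>graph_components {..<n} E. D \<noteq> C \<longrightarrow> card D < card C) \<and>
        \<bar>real (card C) - (1 - \<rho>) * n\<bar> \<le> \<epsilon> * ((1 - \<rho>) * n) \<and>
        (\<forall>D\<in>graph_components {..<n} E. D \<noteq> C \<longrightarrow> real (card D) \<le> L)}"
    (is "_ \<le> measure_pmf.prob ?G ?event")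
proof -
  \<comment> \<open>With these roundings the integer bounds \<open>k < card C\<close>,
    \<open>card C \<le> u\<close> and \<open>card D < l\<close> give the real bounds without
    loss.\<close>
  define l k u where "l = nat \<lceil>L\<rceil>" "k = nat \<lfloor>(1 - \<epsilon>) * ((1 - \<rho>) * n)\<rfloor>"
    "u = nat \<lfloor>(1 + \<epsilon>) * ((1 - \<rho>) * n)\<rfloor>"
  have L0: "0 \<le> L" using n eta c M by (simp add: L(1))
  define bad where "bad = {(R, I). \<exists>t\<le>n. (L \<le> t \<and> t \<le> n * s0 \<and> card (discovered n R I t) \<le> t) \<or>
      \<bar>card (discovered n R I t) - n * (1 - f (1 - t / n))\<bar> \<ge> x}"
  have bad: "measure_pmf.prob (pair_pmf B B) bad \<le> 6 * (n + 1) / n ^ 3"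
    unfolding bad_def by (rule prob_discovered_bad[OF half L(1) x(2,3)])
  have good: "2 * l \<le> k \<and> component_dichotomy n l k u v (intersection_graph (merged_graph (start_at v) n R I))"
    if "(R, I) \<in> set_pmf (pair_pmf B B)" "(R, I) \<notin> bad" "v < n" for R I v
  proof -
    have sub: "R \<subseteq> {..<n} \<times> {..<m}" "I \<subseteq> {..<n} \<times> {..<m}"
      using that(1) random_bipartite_subset[of _ n m p] by (auto simp: B_def)
    have low: "t < card (discovered n R I t)" if "t \<le> n" "L \<le> t" "t \<le> n * s0" for t
      using \<open>(R, I) \<notin> bad\<close> that unfolding bad_def by (simp add: linorder_not_less[symmetric]) blast
    have conc: "\<bar>card (discovered n R I t) - n * (1 - f (1 - t / n))\<bar> < x" if "t \<le> n" for t
      using \<open>(R, I) \<notin> bad\<close> that unfolding bad_def by (simp add: linorder_not_less[symmetric]) blast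
    show ?thesis
      unfolding l_k_u_def
      by (intro conjI component_dichotomy_of_discovered[OF \<rho> \<epsilon> sub L0 L(2,3) x(1) low conc that(3)])
  qed
  \<comment> \<open>\<open>2 * l \<le> k\<close> is deterministic, so one outcome outside
    \<open>bad\<close> suffices to establish it.\<close>
  have lk: "2 * l \<le> k" if "measure_pmf.prob (pair_pmf B B) bad < 1"
  proof (rule ccontr)
    assume "\<not> 2 * l \<le> k"
    then have "y \<in> bad" if "y \<in> set_pmf (pair_pmf B B)" for y
      using good[of "fst y" "snd y" 0] that n by (metis less_le_trans prod.collapse zero_less_one)
    then have "measure_pmf.prob (pair_pmf B B) bad = 1" by (simp add: measure_pmf.prob_eq_1 AE_measure_pmf_iff subset_iff)
    then show False using that by simp
  qed
  have G: "?G = map_pmf (\<lambda>(R, I). intersection_graph (merged_graph (start_at v) n R I)) (pair_pmf B B)" for v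
  proof -
    interpret selection "start_at v" by (rule selection_start_at)
    have "random_bipartite n m p = map_pmf (\<lambda>(R, I). merged_graph (start_at v) n R I) (pair_pmf B B)"
      using map_pmf_merged_graph[of m p n, OF prob] by (simp only: B_def)
    then show ?thesis
      unfolding random_intersection_graph_def by (simp add: pmf.map_comp o_def case_prod_unfold)
  qed
  have fail: "measure_pmf.prob ?G {E. \<not> component_dichotomy n l k u v E} \<le> 6 * (n + 1) / n ^ 3" if v: "v < n" for v
  proof -
    have "measure_pmf.prob ?G {E. \<not> component_dichotomy n l k u v E} \<le> measure_pmf.prob (pair_pmf B B) bad"
      unfolding G[of v] measure_map_pmf
    proof (rule measure_pmf.finite_measure_mono_AE)
      show "AE y in measure_pmf (pair_pmf B B).
          y \<in> (\<lambda>(R, I). intersection_graph (merged_graph (start_at v) n R I)) -`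
            {E. \<not> component_dichotomy n l k u v E} \<longrightarrow> y \<in> bad"
        unfolding AE_measure_pmf_iff
      proof (intro ballI impI, rule ccontr)
        fix y assume y: "y \<in> set_pmf (pair_pmf B B)" "y \<notin> bad"
          "y \<in> (\<lambda>(R, I). intersection_graph (merged_graph (start_at v) n R I)) -`
            {E. \<not> component_dichotomy n l k u v E}"
        obtain R I where "y = (R, I)" by force
        then show False using good[of R I v] y v by simp
      qed
    qed simp
    then show ?thesis using bad by simp
  qed
  show ?thesis
  proof (cases "6 * (n + 1) / n ^ 2 < (1 :: real)")
    case False
    then show ?thesis using measure_nonneg[of "measure_pmf ?G" ?event] by linarith
  next
    case True
    have "6 * (n + 1) / n ^ 3 \<le> (6 * (n + 1) / n ^ 2 :: real)"
      using n power_increasing[of 2 3 "real n"] by (intro divide_left_mono) auto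
    then have lk: "2 * l \<le> k" using lk bad True by simp
    have sub: "UNIV - ?event \<subseteq> (\<Union>v<n. {E. \<not> component_dichotomy n l k u v E})"
    proof
      fix E assume E: "E \<in> UNIV - ?event"
      show "E \<in> (\<Union>v<n. {E. \<not> component_dichotomy n l k u v E})"
      proof (rule ccontr)
        assume "E \<notin> (\<Union>v<n. {E. \<not> component_dichotomy n l k u v E})"
        then have "component_dichotomy n l k u v E" if "v < n" for v using that by blast
        from unique_giant[OF this n lk]
        obtain C where C: "C \<in> graph_components {..<n} E" "k < card C" "card C \<le> u"
          and other: "\<forall>D\<in>graph_components {..<n} E. D \<noteq> C \<longrightarrow> card D < l" .
        have T: "0 \<le> (1 - \<rho>) * n" "0 \<le> (1 + \<epsilon>) * ((1 - \<rho>) * n)" using \<rho>(2) \<epsilon> by auto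
        have "(1 - \<epsilon>) * ((1 - \<rho>) * n) \<le> card C" "card C \<le> (1 + \<epsilon>) * ((1 - \<rho>) * n)"
          using C(2,3) T(2) unfolding l_k_u_def by linarith+
        then have "\<bar>real (card C) - (1 - \<rho>) * n\<bar> \<le> \<epsilon> * ((1 - \<rho>) * n)"
          unfolding left_diff_distrib[of 1 \<epsilon>] distrib_right[of 1 \<epsilon>] by linarith
        moreover have "card D < card C" "real (card D) \<le> L"
          if "D \<in> graph_components {..<n} E" "D \<noteq> C" for D
          using other[rule_format, OF that] C(2) lk L0 unfolding l_k_u_def by linarith+
        ultimately have "E \<in> ?event"
          by (intro CollectI bexI[OF _ C(1)] conjI ballI impI)
        then show False using E by simp
      qed
    qed
    have "measure_pmf.prob ?G (UNIV - ?event) \<le> measure_pmf.prob ?G (\<Union>v<n. {E. \<not> component_dichotomy n l k u v E})"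
      by (rule measure_pmf.finite_measure_mono[OF sub]) auto
    also have "\<dots> \<le> (\<Sum>v<n. measure_pmf.prob ?G {E. \<not> component_dichotomy n l k u v E})"
      by (rule measure_pmf.finite_measure_subadditive_finite) auto
    also have "\<dots> \<le> (\<Sum>v<n. 6 * (n + 1) / n ^ 3)"
      using fail by (intro sum_mono) auto
    also have "\<dots> = 6 * (n + 1) / n ^ 2"
      using n by (simp add: power2_eq_square power3_eq_cube)
    finally show ?thesis
      using measure_pmf.prob_compl[of ?event ?G] by simp
  qed
qed

end

section \<open>Asymptotic comparison of the scales\<close>

lemma eventually_scale_conditions:
  fixes \<gamma> c C K :: real
  assumes \<gamma>: "1 / 2 < \<gamma>" and pos: "0 < c" "0 < C" "0 < K"
  shows "\<forall>\<^sub>F n in sequentially. real n powr (- \<gamma>) \<le> 1 / 2"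
    and "\<forall>\<^sub>F n in sequentially. 12 * c \<le> C * real n powr \<gamma>"
    and "\<forall>\<^sub>F n in sequentially. 3 * ln n \<le> (C * real n powr \<gamma> / 4)\<^sup>2 / (2 * c * n)"
    and "\<forall>\<^sub>F n in sequentially. K * real n powr (1 - \<gamma>) * ln n + 2 \<le> C * real n powr \<gamma>"
proof -
  show "\<forall>\<^sub>F n in sequentially. real n powr (- \<gamma>) \<le> 1 / 2" using assms by real_asymp
  show "\<forall>\<^sub>F n in sequentially. 12 * c \<le> C * real n powr \<gamma>" using assms by real_asymp
  show "\<forall>\<^sub>F n in sequentially. 3 * ln n \<le> (C * real n powr \<gamma> / 4)\<^sup>2 / (2 * c * n)"
    using assms by real_asymp
  \<comment> \<open>After division by \<open>n powr \<gamma>\<close> the first term is of order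
    \<open>n powr (1 - 2 * \<gamma>) * ln n\<close>, which vanishes because
    \<open>\<gamma> > 1 / 2\<close>.\<close>
  define \<delta> where "\<delta> = 2 * \<gamma> - 1"
  have "0 < \<delta>" using \<gamma> by (simp add: \<delta>_def)
  then have "(\<lambda>n. K * (real n powr (- \<delta>) * ln n)) \<longlonglongrightarrow> 0" by real_asymp
  moreover have "(\<lambda>n. 2 * real n powr (- \<gamma>)) \<longlonglongrightarrow> 0" using \<gamma> by real_asymp
  ultimately have "(\<lambda>n. K * (real n powr (- \<delta>) * ln n) + 2 * real n powr (- \<gamma>)) \<longlonglongrightarrow> 0"
    by (rule tendsto_add_zero)
  then have "\<forall>\<^sub>F n in sequentially. K * (real n powr (- \<delta>) * ln n) + 2 * real n powr (- \<gamma>) < C"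
    using pos by (intro order_tendstoD(2))
  then show "\<forall>\<^sub>F n in sequentially. K * real n powr (1 - \<gamma>) * ln n + 2 \<le> C * real n powr \<gamma>"
    using eventually_gt_at_top[of 0]
  proof eventually_elim
    case (elim n)
    have "(K * (real n powr (- \<delta>) * ln n) + 2 * real n powr (- \<gamma>)) * real n powr \<gamma> \<le> C * real n powr \<gamma>"
      using elim by (intro mult_right_mono) auto
    moreover have "real n powr (- \<delta>) * real n powr \<gamma> = real n powr (1 - \<gamma>)"
      using elim by (simp add: \<delta>_def flip: powr_add)
    moreover have "real n powr (- \<gamma>) * real n powr \<gamma> = 1"
      using elim by (simp flip: powr_add)
    ultimately show ?case by (simp add: algebra_simps)
  qed
qed

lemma measure_pmf_prob_mono: "A \<subseteq> A' \<Longrightarrow> measure_pmf.prob M A \<le> measure_pmf.prob M A'"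
  by (rule measure_pmf.finite_measure_mono) auto

text \<open>The size \<open>(1 - \<rho>) * n\<close> is meant up to a factor
  \<open>1 + o(1)\<close>, expressed by an arbitrary \<open>\<epsilon>\<close>. \<open>K\<close> is
  quantified before \<open>\<epsilon>\<close>, so the bound on the other components is uniform in
  the accuracy.\<close>

theorem theorem2:
  fixes c :: real and m :: "nat \<Rightarrow> nat" and p :: "nat \<Rightarrow> nat \<Rightarrow> real"
  assumes prob: "\<And>n i. n \<ge> 1 \<Longrightarrow> i < m n \<Longrightarrow> 0 \<le> p n i \<and> p n i \<le> 1"
    and c: "c > 1"
    and sum_sq: "\<And>n. n \<ge> 1 \<Longrightarrow> real n * (\<Sum>i<m n. (p n i)\<^sup>2) = c"
    and max_small: "\<exists>\<gamma>::real. \<gamma> > 1/2 \<and>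
      (\<lambda>n. max_prob (m n) (p n)) \<in> o(\<lambda>n. real n powr (- \<gamma>))"
  shows "\<exists>\<rho> :: nat \<Rightarrow> real.
    (\<forall>n\<ge>1. \<rho> n \<in> {0..<1} \<and> \<rho> n = extinction_fun n (m n) (p n) (\<rho> n) \<and>
       (\<forall>x\<in>{0..<1}. x = extinction_fun n (m n) (p n) x \<longrightarrow> x = \<rho> n)) \<and>
    (\<exists>K>0. \<forall>\<epsilon>>0.
       (\<lambda>n. measure_pmf.prob (random_intersection_graph n (m n) (p n))
          {E. \<exists>C \<in> graph_components {..<n} E.
             (\<forall>D \<in> graph_components {..<n} E. D \<noteq> C \<longrightarrow> card D < card C) \<and>
             \<bar>real (card C) - (1 - \<rho> n) * real n\<bar> \<le> \<epsilon> * ((1 - \<rho> n) * real n) \<and>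
             (\<forall>D \<in> graph_components {..<n} E. D \<noteq> C \<longrightarrow>
                real (card D) \<le>
                  K * max (real n * max_prob (m n) (p n) * ln (real n)) (ln (real n)))})
       \<longlonglongrightarrow> 1)"
proof -
  define P where "P n = max_prob (m n) (p n)" for n
  define M where "M n = max 1 (real n * P n)" for n
  have le_P: "p n i \<le> P n" if "i < m n" for n i
    unfolding P_def max_prob_def using that by (intro Max_ge) auto
  have params: "rig_params n (m n) (p n) c (M n)" if "n \<ge> 1" for n
  proof
    show "real n * p n i \<le> M n" if "i < m n" for i
      using le_P[OF that] mult_left_mono[of "p n i" "P n" "real n"] by (simp add: M_def)
  qed (use prob[OF that] c sum_sq[OF that] that in \<open>auto simp: M_def\<close>)
  define \<rho> where "\<rho> n = (SOME x. 0 \<le> x \<and> x < 1 \<and> x = extinction_fun n (m n) (p n) x)" for n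
  have \<rho>: "0 \<le> \<rho> n" "\<rho> n < 1" "\<rho> n = extinction_fun n (m n) (p n) (\<rho> n)" if "n \<ge> 1" for n
    using someI_ex[OF rig_params.ex_fixed_point[OF params[OF that]]] unfolding \<rho>_def by blast+
  define \<eta> where "\<eta> = rig_params.\<eta> c"
  have \<eta>: "\<eta> > 0" using rig_params.eta(1)[OF params[OF order_refl]] by (simp add: \<eta>_def)
  define K where "K = 12 / (\<eta> * (c - 1))"
  have K: "K > 0" using \<eta> c by (simp add: K_def)
  obtain \<gamma>0 where \<gamma>0: "\<gamma>0 > 1 / 2" "P \<in> o(\<lambda>n. real n powr (- \<gamma>0))"
    using max_small unfolding P_def by blast
  \<comment> \<open>Capping the exponent at 1 makes \<open>n powr (1 - \<gamma>)\<close> at least 1,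
    so that it bounds \<open>M n\<close> including its lower cutoff 1.\<close>
  define \<gamma> where "\<gamma> = min \<gamma>0 1"
  have \<gamma>: "1 / 2 < \<gamma>" "\<gamma> \<le> 1" using \<gamma>0 by (auto simp: \<gamma>_def)
  have "\<forall>\<^sub>F n in sequentially. norm (P n) \<le> 1 * norm (real n powr (- \<gamma>0))"
    by (rule landau_o.smallD[OF \<gamma>0(2)]) simp
  then have P_small: "\<forall>\<^sub>F n in sequentially. P n \<le> real n powr (- \<gamma>)"
    using eventually_ge_at_top[of 1]
  proof eventually_elim
    case (elim n)
    then have "P n \<le> real n powr (- \<gamma>0)" by simp
    also have "\<dots> \<le> real n powr (- \<gamma>)" using elim by (intro powr_mono) (auto simp: \<gamma>_def)
    finally show ?case .
  qed
  define event where "event \<epsilon> n = {E. \<exists>C \<in> graph_components {..<n} E.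
      (\<forall>D \<in> graph_components {..<n} E. D \<noteq> C \<longrightarrow> card D < card C) \<and>
      \<bar>real (card C) - (1 - \<rho> n) * real n\<bar> \<le> \<epsilon> * ((1 - \<rho> n) * real n) \<and>
      (\<forall>D \<in> graph_components {..<n} E. D \<noteq> C \<longrightarrow>
         real (card D) \<le> K * max (real n * P n * ln (real n)) (ln (real n)))}" for \<epsilon> n
  have limit: "(\<lambda>n. measure_pmf.prob (random_intersection_graph n (m n) (p n)) (event \<epsilon>0 n)) \<longlonglongrightarrow> 1"
    if "\<epsilon>0 > 0" for \<epsilon>0
  proof (rule tendsto_sandwich[of "\<lambda>n. 1 - 6 * (real n + 1) / real n ^ 2" _ _ "\<lambda>_. 1"])
    \<comment> \<open>The event grows with \<open>\<epsilon>\<close>, so it suffices to treat an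
      accuracy of at most \<open>1 / 4\<close>.\<close>
    define \<epsilon> where "\<epsilon> = min \<epsilon>0 (1 / 4)"
    have \<epsilon>: "0 < \<epsilon>" "\<epsilon> \<le> 1 / 4" "\<epsilon> \<le> \<epsilon>0" using that by (auto simp: \<epsilon>_def)
    \<comment> \<open>\<open>C * n powr \<gamma>\<close> is a lower bound for the tolerated
      deviation \<open>x\<close>, by \<open>excess_s0\<close> and
      \<open>n powr \<gamma> \<le> n / M n\<close>.\<close>
    define C where "C = \<epsilon> * ((c - 1) / 2 * \<eta>) / 4"
    have C: "C > 0" using \<epsilon> c \<eta> by (simp add: C_def)
    have c0: "0 < c" and \<eta>4: "0 < \<eta> / 4" using c \<eta> by auto
    show "\<forall>\<^sub>F n in sequentially. 1 - 6 * (real n + 1) / real n ^ 2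
       \<le> measure_pmf.prob (random_intersection_graph n (m n) (p n)) (event \<epsilon>0 n)"
      using P_small eventually_ge_at_top[of 1] eventually_scale_conditions[OF \<gamma>(1) c0 C K]
        eventually_scale_conditions(4)[OF \<gamma>(1) c0 \<eta>4 K]
    proof eventually_elim
      case (elim n)
      have n: "n \<ge> 1" "real n \<ge> 1" "real n > 0" using elim by auto
      interpret G: rig_params n "m n" "p n" c "M n" by (rule params[OF n(1)])
      have np: "real n powr (1 - \<gamma>) * real n powr \<gamma> = n" using n by (simp flip: powr_add)
      have "n * P n \<le> real n powr 1 * real n powr (- \<gamma>)" using elim n by (simp add: mult_left_mono)
      also have "\<dots> = real n powr (1 - \<gamma>)" using powr_add[of "real n" 1 "- \<gamma>"] by simp
      finally have M: "M n \<le> real n powr (1 - \<gamma>)" using n \<gamma> by (simp add: M_def ge_one_powr_ge_zero)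
      have nM: "real n powr \<gamma> \<le> n / M n"
      proof -
        have "real n powr \<gamma> * M n \<le> real n powr \<gamma> * real n powr (1 - \<gamma>)" using M by (intro mult_left_mono) auto
        then have "real n powr \<gamma> * M n \<le> n" using np by (simp add: mult.commute)
        then show ?thesis using G.M by (simp add: field_simps)
      qed
      define x where "x = \<epsilon> * n * G.excess G.s0 / 4"
      define L where "L = K * M n * ln n"
      have ns0: "n * G.s0 = \<eta> * (n / M n)" by (simp add: G.s0_def \<eta>_def)
      have x: "C * real n powr \<gamma> \<le> x"
      proof -
        have "C * real n powr \<gamma> \<le> C * (n / M n)" using nM C by (intro mult_left_mono) auto
        also have "\<dots> = \<epsilon> * n * ((c - 1) / 2 * G.s0) / 4" by (simp add: C_def G.s0_def \<eta>_def)
        also have "\<dots> \<le> x" unfolding x_def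
          using G.excess_s0(1) \<epsilon> by (intro divide_right_mono mult_left_mono) auto
        finally show ?thesis .
      qed
      have L: "L \<le> K * real n powr (1 - \<gamma>) * ln n"
        unfolding L_def using M K n by (intro mult_right_mono mult_left_mono) auto
      have half: "p n i \<le> 1 / 2" if "i < m n" for i
        using le_P[OF that] elim by linarith
      have "\<eta> / 4 * real n powr \<gamma> \<le> n * G.s0 / 4"
        using mult_left_mono[OF nM, of "\<eta> / 4"] \<eta> by (simp add: ns0)
      then have L_s0: "L + 2 \<le> n * G.s0 / 4" using L elim by linarith
      have L_x: "L + 2 \<le> x" using L x elim by linarith
      have x_c: "12 * c \<le> x" using x elim by linarith
      have x_n: "3 * ln n \<le> (x / 4)\<^sup>2 / (2 * c * n)"
      proof -
        have "(C * real n powr \<gamma> / 4)\<^sup>2 / (2 * c * n) \<le> (x / 4)\<^sup>2 / (2 * c * n)"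
          using x C c0 by (intro divide_right_mono power_mono) auto
        then show ?thesis using elim by linarith
      qed
      have "1 - 6 * (n + 1) / n ^ 2 \<le> measure_pmf.prob (random_intersection_graph n (m n) (p n))
         {E. \<exists>C\<in>graph_components {..<n} E.
            (\<forall>D\<in>graph_components {..<n} E. D \<noteq> C \<longrightarrow> card D < card C) \<and>
            \<bar>real (card C) - (1 - \<rho> n) * n\<bar> \<le> \<epsilon> * ((1 - \<rho> n) * n) \<and>
            (\<forall>D\<in>graph_components {..<n} E. D \<noteq> C \<longrightarrow> real (card D) \<le> L)}"
        (is "_ \<le> measure_pmf.prob _ ?event")
        by (rule G.prob_giant_component[OF \<rho>[OF n(1)] \<epsilon>(1,2) half _ L_x L_s0 x_def x_c x_n])
          (auto simp: L_def K_def \<eta>_def)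
      also have "\<dots> \<le> measure_pmf.prob (random_intersection_graph n (m n) (p n)) (event \<epsilon>0 n)"
      proof (rule measure_pmf_prob_mono)
        have "0 \<le> ln (real n)" using n by simp
        then have "max (real n * P n * ln n) (ln n) = M n * ln n"
          by (simp add: M_def max_mult_distrib_right max.commute)
        then have L_eq: "L = K * max (real n * P n * ln n) (ln n)" by (simp add: L_def)
        have "\<epsilon> * ((1 - \<rho> n) * n) \<le> \<epsilon>0 * ((1 - \<rho> n) * n)"
          using \<epsilon>(3) \<rho>(2)[OF n(1)] by (intro mult_right_mono) auto
        then show "?event \<subseteq> event \<epsilon>0 n"
          unfolding event_def L_eq by (auto intro: order_trans)
      qed
      finally show ?case by (simp add: add.commute)
    qed
    show "(\<lambda>n. 1 - 6 * (real n + 1) / real n ^ 2) \<longlonglongrightarrow> 1" by real_asymp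
  qed auto
  show ?thesis
  proof (intro exI[of _ \<rho>] conjI allI impI ballI)
    fix n :: nat assume n: "1 \<le> n"
    show "\<rho> n \<in> {0..<1}" "\<rho> n = extinction_fun n (m n) (p n) (\<rho> n)" using \<rho>[OF n] by auto
    show "x = \<rho> n" if "x \<in> {0..<1}" "x = extinction_fun n (m n) (p n) x" for x
      using rig_params.fixed_point_unique[OF params[OF n], of x "\<rho> n"] that \<rho>[OF n] by auto
  next
    show "\<exists>K>0. \<forall>\<epsilon>>0.
       (\<lambda>n. measure_pmf.prob (random_intersection_graph n (m n) (p n))
          {E. \<exists>C \<in> graph_components {..<n} E.
             (\<forall>D \<in> graph_components {..<n} E. D \<noteq> C \<longrightarrow> card D < card C) \<and>
             \<bar>real (card C) - (1 - \<rho> n) * real n\<bar> \<le> \<epsilon> * ((1 - \<rho> n) * real n) \<and>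
             (\<forall>D \<in> graph_components {..<n} E. D \<noteq> C \<longrightarrow>
                real (card D) \<le>
                  K * max (real n * max_prob (m n) (p n) * ln (real n)) (ln (real n)))})
       \<longlonglongrightarrow> 1"
      using limit K unfolding event_def P_def by blast
  qed
qed

end
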